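(* Every two-sided ideal of $\Gamma^\infty$ is flat both as a left and as a right $\Gamma^\infty$-module.
   Context: $\Gamma^\infty$ is the ring, under matrix multiplication, of complex matrices $(A_{ij})_{i,j\in\mathbb N}$ with $\sup_{i,j}|A_{ij}|<\infty$ for which there is a uniform finite bound on the number of nonzero entries in each row and in each column. *)

theory Defs
  imports Complex_Main "HOL-Library.Groups_Big_Fun" "HOL-Algebra.Free_Abelian_Groups"
    "HOL-Algebra.Generated_Groups" "HOL-Algebra.Module" "HOL-Algebra.Ideal"
begin

section \<open>The ring of bounded matrices with uniformly sparse rows and columns\<close>

definition Gamma_infty_carrier :: "(nat \<Rightarrow> nat \<Rightarrow> complex) set" where
  "Gamma_infty_carrier =
    {A. (\<exists>C. \<forall>i j. cmod (A i j) \<le> C) \<and>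
        (\<exists>b. (\<forall>i. finite {j. A i j \<noteq> 0} \<and> card {j. A i j \<noteq> 0} \<le> b) \<and>
             (\<forall>j. finite {i. A i j \<noteq> 0} \<and> card {i. A i j \<noteq> 0} \<le> b))}"

(* Sum_any sums over the support, which is finite for matrices in the carrier. *)
definition inf_mat_mult :: "(nat \<Rightarrow> nat \<Rightarrow> complex) \<Rightarrow> (nat \<Rightarrow> nat \<Rightarrow> complex) \<Rightarrow> nat \<Rightarrow> nat \<Rightarrow> complex" where
  "inf_mat_mult A B = (\<lambda>i j. Sum_any (\<lambda>k. A i k * B k j))"

definition Gamma_infty :: "(nat \<Rightarrow> nat \<Rightarrow> complex) ring" where
  "Gamma_infty =
    \<lparr>carrier = Gamma_infty_carrier,
     monoid.mult = inf_mat_mult,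
     one = (\<lambda>i j. if i = j then 1 else 0),
     ring.zero = (\<lambda>i j. 0),
     ring.add = (\<lambda>A B i j. A i j + B i j)\<rparr>"


section \<open>Modules over a not necessarily commutative ring\<close>

(* Both kinds of module use the record type of HOL-Algebra.Module, whose multiplicative fields
   are ignored. In a right module, "a \<odot> x" stands for the right action x a; hence rsmult_assoc. *)

locale left_module = R?: ring R + M?: abelian_group M
  for R :: "('a, 'r) ring_scheme" (structure) and M :: "('a, 'b, 'm) module_scheme" (structure) +
  assumes lsmult_closed:
      "\<lbrakk>a \<in> carrier R; x \<in> carrier M\<rbrakk> \<Longrightarrow> a \<odot>\<^bsub>M\<^esub> x \<in> carrier M"
    and lsmult_l_distr:
      "\<lbrakk>a \<in> carrier R; b \<in> carrier R; x \<in> carrier M\<rbrakk> \<Longrightarrow>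
        (a \<oplus>\<^bsub>R\<^esub> b) \<odot>\<^bsub>M\<^esub> x = a \<odot>\<^bsub>M\<^esub> x \<oplus>\<^bsub>M\<^esub> b \<odot>\<^bsub>M\<^esub> x"
    and lsmult_r_distr:
      "\<lbrakk>a \<in> carrier R; x \<in> carrier M; y \<in> carrier M\<rbrakk> \<Longrightarrow>
        a \<odot>\<^bsub>M\<^esub> (x \<oplus>\<^bsub>M\<^esub> y) = a \<odot>\<^bsub>M\<^esub> x \<oplus>\<^bsub>M\<^esub> a \<odot>\<^bsub>M\<^esub> y"
    and lsmult_assoc:
      "\<lbrakk>a \<in> carrier R; b \<in> carrier R; x \<in> carrier M\<rbrakk> \<Longrightarrow>
        (a \<otimes>\<^bsub>R\<^esub> b) \<odot>\<^bsub>M\<^esub> x = a \<odot>\<^bsub>M\<^esub> (b \<odot>\<^bsub>M\<^esub> x)"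
    and lsmult_one:
      "x \<in> carrier M \<Longrightarrow> \<one>\<^bsub>R\<^esub> \<odot>\<^bsub>M\<^esub> x = x"

locale right_module = R?: ring R + M?: abelian_group M
  for R :: "('a, 'r) ring_scheme" (structure) and M :: "('a, 'b, 'm) module_scheme" (structure) +
  assumes rsmult_closed:
      "\<lbrakk>a \<in> carrier R; x \<in> carrier M\<rbrakk> \<Longrightarrow> a \<odot>\<^bsub>M\<^esub> x \<in> carrier M"
    and rsmult_l_distr:
      "\<lbrakk>a \<in> carrier R; b \<in> carrier R; x \<in> carrier M\<rbrakk> \<Longrightarrow>
        (a \<oplus>\<^bsub>R\<^esub> b) \<odot>\<^bsub>M\<^esub> x = a \<odot>\<^bsub>M\<^esub> x \<oplus>\<^bsub>M\<^esub> b \<odot>\<^bsub>M\<^esub> x"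
    and rsmult_r_distr:
      "\<lbrakk>a \<in> carrier R; x \<in> carrier M; y \<in> carrier M\<rbrakk> \<Longrightarrow>
        a \<odot>\<^bsub>M\<^esub> (x \<oplus>\<^bsub>M\<^esub> y) = a \<odot>\<^bsub>M\<^esub> x \<oplus>\<^bsub>M\<^esub> a \<odot>\<^bsub>M\<^esub> y"
    and rsmult_assoc:
      "\<lbrakk>a \<in> carrier R; b \<in> carrier R; x \<in> carrier M\<rbrakk> \<Longrightarrow>
        (a \<otimes>\<^bsub>R\<^esub> b) \<odot>\<^bsub>M\<^esub> x = b \<odot>\<^bsub>M\<^esub> (a \<odot>\<^bsub>M\<^esub> x)"
    and rsmult_one:
      "x \<in> carrier M \<Longrightarrow> \<one>\<^bsub>R\<^esub> \<odot>\<^bsub>M\<^esub> x = x"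

definition module_homs ::
  "('a, 'r) ring_scheme \<Rightarrow> ('a, 'b, 'm) module_scheme \<Rightarrow> ('a, 'c, 'n) module_scheme \<Rightarrow> ('b \<Rightarrow> 'c) set" where
  "module_homs R M N =
    {f. f \<in> carrier M \<rightarrow> carrier N \<and>
        (\<forall>x\<in>carrier M. \<forall>y\<in>carrier M. f (x \<oplus>\<^bsub>M\<^esub> y) = f x \<oplus>\<^bsub>N\<^esub> f y) \<and>
        (\<forall>a\<in>carrier R. \<forall>x\<in>carrier M. f (a \<odot>\<^bsub>M\<^esub> x) = a \<odot>\<^bsub>N\<^esub> f x)}"

definition left_ideal_module :: "('a, 'r) ring_scheme \<Rightarrow> 'a set \<Rightarrow> ('a, 'a) module" where
  "left_ideal_module R I =
    \<lparr>carrier = I, monoid.mult = monoid.mult R, one = one R,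
     ring.zero = ring.zero R, ring.add = ring.add R,
     smult = (\<lambda>a x. a \<otimes>\<^bsub>R\<^esub> x)\<rparr>"

definition right_ideal_module :: "('a, 'r) ring_scheme \<Rightarrow> 'a set \<Rightarrow> ('a, 'a) module" where
  "right_ideal_module R I =
    \<lparr>carrier = I, monoid.mult = monoid.mult R, one = one R,
     ring.zero = ring.zero R, ring.add = ring.add R,
     smult = (\<lambda>a x. x \<otimes>\<^bsub>R\<^esub> a)\<rparr>"


section \<open>Tensor products and flatness\<close>

(* Throughout, the first factor M is a right module and the second factor N a left module; the
   last family of relators identifies x a \<otimes> y with x \<otimes> a y. *)

definition tensor_relators ::
  "('a, 'r) ring_scheme \<Rightarrow> ('a, 'b, 'm) module_scheme \<Rightarrow> ('a, 'c, 'n) module_scheme \<Rightarrow>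
    ('b \<times> 'c \<Rightarrow>\<^sub>0 int) set" where
  "tensor_relators R M N =
    {frag_of (x \<oplus>\<^bsub>M\<^esub> x', y) - frag_of (x, y) - frag_of (x', y) | x x' y.
      x \<in> carrier M \<and> x' \<in> carrier M \<and> y \<in> carrier N} \<union>
    {frag_of (x, y \<oplus>\<^bsub>N\<^esub> y') - frag_of (x, y) - frag_of (x, y') | x y y'.
      x \<in> carrier M \<and> y \<in> carrier N \<and> y' \<in> carrier N} \<union>
    {frag_of (a \<odot>\<^bsub>M\<^esub> x, y) - frag_of (x, a \<odot>\<^bsub>N\<^esub> y) | a x y.
      a \<in> carrier R \<and> x \<in> carrier M \<and> y \<in> carrier N}"

definition tensor_kernel ::
  "('a, 'r) ring_scheme \<Rightarrow> ('a, 'b, 'm) module_scheme \<Rightarrow> ('a, 'c, 'n) module_scheme \<Rightarrow>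
    ('b \<times> 'c \<Rightarrow>\<^sub>0 int) set" where
  "tensor_kernel R M N =
    generate (free_Abelian_group (carrier M \<times> carrier N)) (tensor_relators R M N)"

definition tensor_product ::
  "('a, 'r) ring_scheme \<Rightarrow> ('a, 'b, 'm) module_scheme \<Rightarrow> ('a, 'c, 'n) module_scheme \<Rightarrow>
    ('b \<times> 'c \<Rightarrow>\<^sub>0 int) set monoid" where
  "tensor_product R M N =
    free_Abelian_group (carrier M \<times> carrier N) Mod tensor_kernel R M N"

definition tensor_class ::
  "('a, 'r) ring_scheme \<Rightarrow> ('a, 'b, 'm) module_scheme \<Rightarrow> ('a, 'c, 'n) module_scheme \<Rightarrow>
    ('b \<times> 'c \<Rightarrow>\<^sub>0 int) \<Rightarrow> ('b \<times> 'c \<Rightarrow>\<^sub>0 int) set" where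
  "tensor_class R M N c =
    tensor_kernel R M N #>\<^bsub>free_Abelian_group (carrier M \<times> carrier N)\<^esub> c"

(* The map f \<otimes> g into the tensor product of M' and N', on cosets: the class of \<Sum> n\<^sub>i (x\<^sub>i, y\<^sub>i) goes to
   the class of \<Sum> n\<^sub>i (f x\<^sub>i, g y\<^sub>i); see tensor_map_class for well-definedness. *)
definition tensor_map ::
  "('a, 'r) ring_scheme \<Rightarrow> ('a, 'd, 'm) module_scheme \<Rightarrow> ('a, 'e, 'n) module_scheme \<Rightarrow>
    ('b \<Rightarrow> 'd) \<Rightarrow> ('c \<Rightarrow> 'e) \<Rightarrow> ('b \<times> 'c \<Rightarrow>\<^sub>0 int) set \<Rightarrow> ('d \<times> 'e \<Rightarrow>\<^sub>0 int) set" where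
  "tensor_map R M' N' f g T =
    the_elem ((\<lambda>c. tensor_class R M' N' (frag_extend (\<lambda>(x, y). frag_of (f x, g y)) c)) ` T)"

(* Flatness: tensoring with M preserves injectivity of module homomorphisms.
   HOL cannot quantify over types inside a formula, so the types of the elements of the test
   modules are parameters. A theorem in which they are type variables asserts flatness with
   respect to all test modules. *)

definition flat_right_module ::
  "'b itself \<Rightarrow> 'c itself \<Rightarrow> ('a, 'r) ring_scheme \<Rightarrow> ('a, 'd, 'm) module_scheme \<Rightarrow> bool" where
  "flat_right_module _ _ R M \<longleftrightarrow>
    right_module R M \<and>
    (\<forall>(A :: ('a, 'b) module) (B :: ('a, 'c) module) f.
      left_module R A \<and> left_module R B \<and> f \<in> module_homs R A B \<and> inj_on f (carrier A) \<longrightarrow>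
      inj_on (tensor_map R M B id f) (carrier (tensor_product R M A)))"

definition flat_left_module ::
  "'b itself \<Rightarrow> 'c itself \<Rightarrow> ('a, 'r) ring_scheme \<Rightarrow> ('a, 'd, 'm) module_scheme \<Rightarrow> bool" where
  "flat_left_module _ _ R M \<longleftrightarrow>
    left_module R M \<and>
    (\<forall>(A :: ('a, 'b) module) (B :: ('a, 'c) module) f.
      right_module R A \<and> right_module R B \<and> f \<in> module_homs R A B \<and> inj_on f (carrier A) \<longrightarrow>
      inj_on (tensor_map R B M f id) (carrier (tensor_product R A M)))"


section \<open>Basic facts\<close>

lemma Gamma_infty_carrierD:
  assumes "A \<in> Gamma_infty_carrier"
  shows "finite {j. A i j \<noteq> 0}" "finite {i. A i j \<noteq> 0}"
  using assms by (auto simp: Gamma_infty_carrier_def)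

lemma Gamma_infty_carrierE:
  assumes "A \<in> Gamma_infty_carrier"
  obtains C b where "C \<ge> 0" "\<And>i j. cmod (A i j) \<le> C"
    "\<And>i. card {j. A i j \<noteq> 0} \<le> b" "\<And>j. card {i. A i j \<noteq> 0} \<le> b"
proof -
  obtain C b where *: "\<forall>i j. cmod (A i j) \<le> C"
    "\<forall>i. card {j. A i j \<noteq> 0} \<le> b" "\<forall>j. card {i. A i j \<noteq> 0} \<le> b"
    using assms unfolding Gamma_infty_carrier_def by blast
  moreover have "C \<ge> 0" using *(1) norm_ge_zero order_trans by blast
  ultimately show thesis using that by blast
qed

lemma inf_mat_mult_row:
  assumes "finite S" "{k. A i k \<noteq> 0} \<subseteq> S"
  shows "inf_mat_mult A B i j = (\<Sum>k\<in>S. A i k * B k j)"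
  unfolding inf_mat_mult_def by (rule Sum_any.expand_superset) (use assms in auto)

lemma inf_mat_mult_col:
  assumes "finite S" "{k. B k j \<noteq> 0} \<subseteq> S"
  shows "inf_mat_mult A B i j = (\<Sum>k\<in>S. A i k * B k j)"
  unfolding inf_mat_mult_def by (rule Sum_any.expand_superset) (use assms in auto)

lemma inf_mat_mult_closed:
  assumes A: "A \<in> Gamma_infty_carrier" and B: "B \<in> Gamma_infty_carrier"
  shows "inf_mat_mult A B \<in> Gamma_infty_carrier"
proof -
  note fA = Gamma_infty_carrierD[OF A] and fB = Gamma_infty_carrierD[OF B]
  obtain C b where C: "C \<ge> 0" "\<And>i j. cmod (A i j) \<le> C"
    "\<And>i. card {j. A i j \<noteq> 0} \<le> b" "\<And>j. card {i. A i j \<noteq> 0} \<le> b"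
    using Gamma_infty_carrierE[OF A] by blast
  obtain D d where D: "D \<ge> 0" "\<And>i j. cmod (B i j) \<le> D"
    "\<And>i. card {j. B i j \<noteq> 0} \<le> d" "\<And>j. card {i. B i j \<noteq> 0} \<le> d"
    using Gamma_infty_carrierE[OF B] by blast
  have 1: "cmod (inf_mat_mult A B i j) \<le> of_nat b * (C * D)" for i j
  proof -
    have "cmod (inf_mat_mult A B i j) \<le> (\<Sum>k\<in>{k. A i k \<noteq> 0}. cmod (A i k * B k j))"
      by (subst inf_mat_mult_row[OF fA(1) order_refl]) (rule norm_sum)
    also have "\<dots> \<le> of_nat (card {k. A i k \<noteq> 0}) * (C * D)"
      by (rule sum_bounded_above) (auto simp: norm_mult intro!: mult_mono C D)
    also have "\<dots> \<le> of_nat b * (C * D)"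
      using C D by (intro mult_right_mono) auto
    finally show ?thesis .
  qed
  have nz: "\<exists>k. A i k \<noteq> 0 \<and> B k j \<noteq> 0" if "inf_mat_mult A B i j \<noteq> 0" for i j
    using that sum.not_neutral_contains_not_neutral[of "\<lambda>k. A i k * B k j" "{k. A i k \<noteq> 0}"]
    by (auto simp: inf_mat_mult_row[OF fA(1) order_refl])
  have 2: "{j. inf_mat_mult A B i j \<noteq> 0} \<subseteq> (\<Union>k\<in>{k. A i k \<noteq> 0}. {j. B k j \<noteq> 0})" for i
    using nz by auto
  have 3: "{i. inf_mat_mult A B i j \<noteq> 0} \<subseteq> (\<Union>k\<in>{k. B k j \<noteq> 0}. {i. A i k \<noteq> 0})" for j
    using nz by fastforce
  have 4: "finite {j. inf_mat_mult A B i j \<noteq> 0} \<and> card {j. inf_mat_mult A B i j \<noteq> 0} \<le> b * d" for i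
  proof
    show "finite {j. inf_mat_mult A B i j \<noteq> 0}"
      by (rule finite_subset[OF 2]) (use fA fB in auto)
    have "card {j. inf_mat_mult A B i j \<noteq> 0} \<le> card (\<Union>k\<in>{k. A i k \<noteq> 0}. {j. B k j \<noteq> 0})"
      by (rule card_mono[OF _ 2]) (use fA fB in auto)
    also have "\<dots> \<le> (\<Sum>k\<in>{k. A i k \<noteq> 0}. card {j. B k j \<noteq> 0})"
      by (rule card_UN_le) (use fA in auto)
    also have "\<dots> \<le> card {k. A i k \<noteq> 0} * d"
      using sum_bounded_above[of "{k. A i k \<noteq> 0}" "\<lambda>k. card {j. B k j \<noteq> 0}" d] D by auto
    also have "\<dots> \<le> b * d" using C by simp
    finally show "card {j. inf_mat_mult A B i j \<noteq> 0} \<le> b * d" .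
  qed
  have 5: "finite {i. inf_mat_mult A B i j \<noteq> 0} \<and> card {i. inf_mat_mult A B i j \<noteq> 0} \<le> b * d" for j
  proof
    show "finite {i. inf_mat_mult A B i j \<noteq> 0}"
      by (rule finite_subset[OF 3]) (use fA fB in auto)
    have "card {i. inf_mat_mult A B i j \<noteq> 0} \<le> card (\<Union>k\<in>{k. B k j \<noteq> 0}. {i. A i k \<noteq> 0})"
      by (rule card_mono[OF _ 3]) (use fA fB in auto)
    also have "\<dots> \<le> (\<Sum>k\<in>{k. B k j \<noteq> 0}. card {i. A i k \<noteq> 0})"
      by (rule card_UN_le) (use fB in auto)
    also have "\<dots> \<le> card {k. B k j \<noteq> 0} * b"
      using sum_bounded_above[of "{k. B k j \<noteq> 0}" "\<lambda>k. card {i. A i k \<noteq> 0}" b] C by auto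
    also have "\<dots> \<le> b * d" using D by (simp add: mult.commute)
    finally show "card {i. inf_mat_mult A B i j \<noteq> 0} \<le> b * d" .
  qed
  show ?thesis unfolding Gamma_infty_carrier_def using 1 4 5 by blast
qed

lemma inf_mat_add_closed:
  assumes A: "A \<in> Gamma_infty_carrier" and B: "B \<in> Gamma_infty_carrier"
  shows "(\<lambda>i j. A i j + B i j) \<in> Gamma_infty_carrier"
proof -
  note fA = Gamma_infty_carrierD[OF A] and fB = Gamma_infty_carrierD[OF B]
  obtain C b where C: "C \<ge> 0" "\<And>i j. cmod (A i j) \<le> C"
    "\<And>i. card {j. A i j \<noteq> 0} \<le> b" "\<And>j. card {i. A i j \<noteq> 0} \<le> b"
    using Gamma_infty_carrierE[OF A] by blast
  obtain D d where D: "D \<ge> 0" "\<And>i j. cmod (B i j) \<le> D"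
    "\<And>i. card {j. B i j \<noteq> 0} \<le> d" "\<And>j. card {i. B i j \<noteq> 0} \<le> d"
    using Gamma_infty_carrierE[OF B] by blast
  have *: "finite {x. u x + v x \<noteq> 0} \<and> card {x. u x + v x \<noteq> 0} \<le> b + d"
    if "finite {x. u x \<noteq> 0}" "finite {x. v x \<noteq> 0}" "card {x. u x \<noteq> 0} \<le> b" "card {x. v x \<noteq> 0} \<le> d"
    for u v :: "nat \<Rightarrow> complex"
  proof -
    have sub: "{x. u x + v x \<noteq> 0} \<subseteq> {x. u x \<noteq> 0} \<union> {x. v x \<noteq> 0}" by auto
    have fin: "finite ({x. u x \<noteq> 0} \<union> {x. v x \<noteq> 0})" using that by simp
    show ?thesis
      using card_mono[OF fin sub] card_Un_le[of "{x. u x \<noteq> 0}" "{x. v x \<noteq> 0}"] that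
        finite_subset[OF sub fin] by linarith
  qed
  have "cmod (A i j + B i j) \<le> C + D" for i j
    using C(2) D(2) norm_triangle_mono by blast
  then show ?thesis
    unfolding Gamma_infty_carrier_def using *[OF fA(1) fB(1) C(3) D(3)] *[OF fA(2) fB(2) C(4) D(4)]
    by blast
qed

lemma inf_mat_mult_assoc:
  assumes A: "A \<in> Gamma_infty_carrier" and D: "D \<in> Gamma_infty_carrier"
  shows "inf_mat_mult (inf_mat_mult A B) D = inf_mat_mult A (inf_mat_mult B D)"
proof (intro ext)
  fix i j
  note fA = Gamma_infty_carrierD(1)[OF A] and fD = Gamma_infty_carrierD(2)[OF D]
  have "inf_mat_mult (inf_mat_mult A B) D i j
      = (\<Sum>l\<in>{l. D l j \<noteq> 0}. (\<Sum>k\<in>{k. A i k \<noteq> 0}. A i k * B k l) * D l j)"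
    by (simp add: inf_mat_mult_col[OF fD order_refl] inf_mat_mult_row[OF fA order_refl])
  also have "\<dots> = (\<Sum>k\<in>{k. A i k \<noteq> 0}. A i k * (\<Sum>l\<in>{l. D l j \<noteq> 0}. B k l * D l j))"
    by (simp add: sum_distrib_left sum_distrib_right mult.assoc)
       (rule sum.swap)
  also have "\<dots> = inf_mat_mult A (inf_mat_mult B D) i j"
    by (simp add: inf_mat_mult_col[OF fD order_refl] inf_mat_mult_row[OF fA order_refl])
  finally show "inf_mat_mult (inf_mat_mult A B) D i j = inf_mat_mult A (inf_mat_mult B D) i j" .
qed

lemma ring_Gamma_infty: "ring Gamma_infty"
proof (rule ringI)
  have zero: "(\<lambda>i j. 0) \<in> Gamma_infty_carrier"
    by (auto simp: Gamma_infty_carrier_def)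
  show "abelian_group Gamma_infty"
  proof (rule abelian_groupI)
    fix A assume "A \<in> carrier Gamma_infty"
    then have "(\<lambda>i j. - A i j) \<in> Gamma_infty_carrier"
      by (simp add: Gamma_infty_def Gamma_infty_carrier_def)
    then show "\<exists>B\<in>carrier Gamma_infty. B \<oplus>\<^bsub>Gamma_infty\<^esub> A = \<zero>\<^bsub>Gamma_infty\<^esub>"
      by (intro bexI[of _ "\<lambda>i j. - A i j"]) (simp_all add: Gamma_infty_def)
  qed (use zero in \<open>auto simp: Gamma_infty_def inf_mat_add_closed add_ac\<close>)
  have card1: "card {j. i = j} = 1" "card {j. j = i} = 1" "finite {j. i = j}" for i :: nat
    by simp_all
  have one: "(\<lambda>i j. if i = j then 1 else 0) \<in> Gamma_infty_carrier"
    unfolding Gamma_infty_carrier_def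
    by (auto intro!: exI[of _ 1] exI[of _ "1::nat"] simp: card1)
  have one_l: "inf_mat_mult (\<lambda>i j. if i = j then 1 else 0) A = A" for A
  proof (intro ext)
    fix i j
    show "inf_mat_mult (\<lambda>i j. if i = j then 1 else 0) A i j = A i j"
      by (subst inf_mat_mult_row[of "{i}"]) auto
  qed
  have one_r: "inf_mat_mult A (\<lambda>i j. if i = j then 1 else 0) = A" for A
  proof (intro ext)
    fix i j
    show "inf_mat_mult A (\<lambda>i j. if i = j then 1 else 0) i j = A i j"
      by (subst inf_mat_mult_col[of "{j}"]) auto
  qed
  show "Group.monoid Gamma_infty"
    by (rule monoidI)
      (simp_all add: Gamma_infty_def inf_mat_mult_closed inf_mat_mult_assoc one one_l one_r)
next
  fix A B D
  assume "A \<in> carrier Gamma_infty" "B \<in> carrier Gamma_infty" "D \<in> carrier Gamma_infty"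
  then have D: "D \<in> Gamma_infty_carrier" by (simp add: Gamma_infty_def)
  note row = inf_mat_mult_row[OF Gamma_infty_carrierD(1)[OF D] order_refl]
    and col = inf_mat_mult_col[OF Gamma_infty_carrierD(2)[OF D] order_refl]
  show "(A \<oplus>\<^bsub>Gamma_infty\<^esub> B) \<otimes>\<^bsub>Gamma_infty\<^esub> D =
      A \<otimes>\<^bsub>Gamma_infty\<^esub> D \<oplus>\<^bsub>Gamma_infty\<^esub> B \<otimes>\<^bsub>Gamma_infty\<^esub> D"
    by (simp add: Gamma_infty_def fun_eq_iff col distrib_right sum.distrib)
  show "D \<otimes>\<^bsub>Gamma_infty\<^esub> (A \<oplus>\<^bsub>Gamma_infty\<^esub> B) =
      D \<otimes>\<^bsub>Gamma_infty\<^esub> A \<oplus>\<^bsub>Gamma_infty\<^esub> D \<otimes>\<^bsub>Gamma_infty\<^esub> B"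
    by (simp add: Gamma_infty_def fun_eq_iff row distrib_left sum.distrib)
qed

lemma (in ideal) abelian_group_ideal_record:
  shows "abelian_group (left_ideal_module R I)" "abelian_group (right_ideal_module R I)"
proof -
  have inv: "\<exists>y\<in>I. y \<oplus> x = \<zero>" if "x \<in> I" for x
    using that a_inv_closed a_Hcarr l_neg by blast
  show "abelian_group (left_ideal_module R I)"
    by (rule abelian_groupI; unfold left_ideal_module_def; simp add: a_Hcarr a_assoc inv)
      (rule a_comm; simp add: a_Hcarr)
  show "abelian_group (right_ideal_module R I)"
    by (rule abelian_groupI; unfold right_ideal_module_def; simp add: a_Hcarr a_assoc inv)
      (rule a_comm; simp add: a_Hcarr)
qed

lemma (in ideal) left_module_ideal: "left_module R (left_ideal_module R I)"
proof -
  interpret M: abelian_group "left_ideal_module R I" by (rule abelian_group_ideal_record)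
  show ?thesis
    by unfold_locales
      (auto simp: left_ideal_module_def I_l_closed l_distr r_distr m_assoc a_Hcarr)
qed

lemma (in ideal) right_module_ideal: "right_module R (right_ideal_module R I)"
proof -
  interpret M: abelian_group "right_ideal_module R I" by (rule abelian_group_ideal_record)
  show ?thesis
    by unfold_locales
      (auto simp: right_ideal_module_def I_r_closed l_distr r_distr m_assoc a_Hcarr)
qed

lemma tensor_relators_subset:
  assumes M: "right_module R M" and N: "left_module R N"
  shows "tensor_relators R M N \<subseteq> carrier (free_Abelian_group (carrier M \<times> carrier N))"
proof -
  interpret M: right_module R M by fact
  interpret N: left_module R N by fact
  let ?F = "free_Abelian_group (carrier M \<times> carrier N)"
  have sub: "c - c' \<in> carrier ?F" if "c \<in> carrier ?F" "c' \<in> carrier ?F" for c c'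
    using that keys_diff[of c c'] by auto
  have of: "frag_of (x, y) \<in> carrier ?F" if "x \<in> carrier M" "y \<in> carrier N" for x y
    using that by simp
  show ?thesis
    unfolding tensor_relators_def
    by (auto simp: M.rsmult_closed N.lsmult_closed simp del: carrier_free_Abelian_group_iff
        intro!: sub of)
qed

lemma tensor_kernel_normal:
  assumes "right_module R M" "left_module R N"
  shows "tensor_kernel R M N \<lhd> free_Abelian_group (carrier M \<times> carrier N)"
proof -
  interpret F: comm_group "free_Abelian_group (carrier M \<times> carrier N)"
    by (rule abelian_free_Abelian_group)
  show ?thesis
    unfolding tensor_kernel_def
    by (intro F.subgroup_imp_normal F.generate_is_subgroup tensor_relators_subset assms)
qed

lemma comm_group_tensor_product:
  assumes "right_module R M" "left_module R N"
  shows "comm_group (tensor_product R M N)"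
proof -
  interpret F: comm_group "free_Abelian_group (carrier M \<times> carrier N)"
    by (rule abelian_free_Abelian_group)
  show ?thesis
    unfolding tensor_product_def
    by (rule F.abelian_FactGroup) (use tensor_kernel_normal[OF assms] normal_imp_subgroup in blast)
qed

lemma tensor_map_class:
  assumes M: "right_module R M" and N: "left_module R N"
    and M': "right_module R M'" and N': "left_module R N'"
    and f: "f \<in> module_homs R M M'" and g: "g \<in> module_homs R N N'"
    and c: "c \<in> carrier (free_Abelian_group (carrier M \<times> carrier N))"
  shows "tensor_map R M' N' f g (tensor_class R M N c) =
    tensor_class R M' N' (frag_extend (\<lambda>(x, y). frag_of (f x, g y)) c)"
proof -
  interpret M: right_module R M by fact
  interpret N: left_module R N by fact
  let ?F = "free_Abelian_group (carrier M \<times> carrier N)"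
  let ?F' = "free_Abelian_group (carrier M' \<times> carrier N')"
  let ?h = "frag_extend (\<lambda>(x, y). frag_of (f x, g y))"
  interpret K: normal "tensor_kernel R M N" ?F by (rule tensor_kernel_normal[OF M N])
  interpret K': normal "tensor_kernel R M' N'" ?F' by (rule tensor_kernel_normal[OF M' N'])
  have h: "?h d \<in> carrier ?F'" if "d \<in> carrier ?F" for d
  proof -
    have "Poly_Mapping.keys (?h d) \<subseteq> (\<Union>x\<in>Poly_Mapping.keys d. Poly_Mapping.keys (case x of (x, y) \<Rightarrow> frag_of (f x, g y)))"
      by (rule keys_frag_extend)
    also have "\<dots> \<subseteq> carrier M' \<times> carrier N'"
      using that f g by (fastforce simp: module_homs_def Pi_iff split: if_splits)
    finally show ?thesis by simp
  qed
  have fM: "f x \<in> carrier M'" "f (x \<oplus>\<^bsub>M\<^esub> x') = f x \<oplus>\<^bsub>M'\<^esub> f x'"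
    if "x \<in> carrier M" "x' \<in> carrier M" for x x'
    using f that by (auto simp: module_homs_def)
  have fR: "f (a \<odot>\<^bsub>M\<^esub> x) = a \<odot>\<^bsub>M'\<^esub> f x" if "a \<in> carrier R" "x \<in> carrier M" for a x
    using f that by (auto simp: module_homs_def)
  have gN: "g y \<in> carrier N'" "g (y \<oplus>\<^bsub>N\<^esub> y') = g y \<oplus>\<^bsub>N'\<^esub> g y'"
    if "y \<in> carrier N" "y' \<in> carrier N" for y y'
    using g that by (auto simp: module_homs_def)
  have gR: "g (a \<odot>\<^bsub>N\<^esub> y) = a \<odot>\<^bsub>N'\<^esub> g y" if "a \<in> carrier R" "y \<in> carrier N" for a y
    using g that by (auto simp: module_homs_def)
  have rel: "?h r \<in> tensor_relators R M' N'" if "r \<in> tensor_relators R M N" for r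
  proof -
    consider
      (add_l) x x' y where "r = frag_of (x \<oplus>\<^bsub>M\<^esub> x', y) - frag_of (x, y) - frag_of (x', y)"
        "x \<in> carrier M" "x' \<in> carrier M" "y \<in> carrier N"
    | (add_r) x y y' where "r = frag_of (x, y \<oplus>\<^bsub>N\<^esub> y') - frag_of (x, y) - frag_of (x, y')"
        "x \<in> carrier M" "y \<in> carrier N" "y' \<in> carrier N"
    | (bal) a x y where "r = frag_of (a \<odot>\<^bsub>M\<^esub> x, y) - frag_of (x, a \<odot>\<^bsub>N\<^esub> y)"
        "a \<in> carrier R" "x \<in> carrier M" "y \<in> carrier N"
      using \<open>r \<in> tensor_relators R M N\<close> unfolding tensor_relators_def by blast
    then show ?thesis
    proof cases
      case add_l
      then have "?h r = frag_of (f x \<oplus>\<^bsub>M'\<^esub> f x', g y) - frag_of (f x, g y) - frag_of (f x', g y)"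
        by (simp add: frag_extend_diff fM)
      moreover have "f x \<in> carrier M'" "f x' \<in> carrier M'" "g y \<in> carrier N'"
        using add_l fM(1) gN(1) by auto
      ultimately show ?thesis unfolding tensor_relators_def by blast
    next
      case add_r
      then have "?h r = frag_of (f x, g y \<oplus>\<^bsub>N'\<^esub> g y') - frag_of (f x, g y) - frag_of (f x, g y')"
        by (simp add: frag_extend_diff gN)
      moreover have "f x \<in> carrier M'" "g y \<in> carrier N'" "g y' \<in> carrier N'"
        using add_r fM(1) gN(1) by auto
      ultimately show ?thesis unfolding tensor_relators_def by blast
    next
      case bal
      then have "?h r = frag_of (a \<odot>\<^bsub>M'\<^esub> f x, g y) - frag_of (f x, a \<odot>\<^bsub>N'\<^esub> g y)"
        by (simp add: frag_extend_diff fR gR)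
      moreover have "a \<in> carrier R" "f x \<in> carrier M'" "g y \<in> carrier N'"
        using bal fM(1) gN(1) by auto
      ultimately show ?thesis unfolding tensor_relators_def by blast
    qed
  qed
  have ker: "?h k \<in> tensor_kernel R M' N'" if "k \<in> tensor_kernel R M N" for k
    using that unfolding tensor_kernel_def
  proof (induction k rule: generate.induct)
    case one
    then show ?case using generate.one[of ?F'] by simp
  next
    case (incl r)
    then show ?case by (intro generate.incl rel)
  next
    case (inv r)
    then have r: "r \<in> carrier ?F" using tensor_relators_subset[OF M N] by blast
    then have "?h (inv\<^bsub>?F\<^esub> r) = inv\<^bsub>?F'\<^esub> (?h r)"
      using h[OF r] by (simp add: frag_extend_minus)
    then show ?case using generate.inv[OF rel[OF inv]] by metis
  next
    case (eng k k')
    then show ?case using generate.eng[of _ ?F'] by (fastforce simp: frag_extend_add)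
  qed
  have const: "tensor_class R M' N' (?h d) = tensor_class R M' N' (?h c)"
    if "d \<in> tensor_class R M N c" for d
  proof -
    obtain k where k: "k \<in> tensor_kernel R M N" "d = k + c"
      using \<open>d \<in> tensor_class R M N c\<close> by (auto simp: tensor_class_def r_coset_def)
    have "?h d = ?h k \<otimes>\<^bsub>?F'\<^esub> ?h c" using k by (simp add: frag_extend_add)
    then have "?h d \<in> tensor_class R M' N' (?h c)"
      using ker[OF k(1)] by (auto simp: tensor_class_def r_coset_def)
    then show ?thesis
      unfolding tensor_class_def using K'.repr_independence[OF _ h[OF c]] K'.subgroup_axioms by metis
  qed
  have "c \<in> tensor_class R M N c"
    unfolding tensor_class_def using K.rcos_self[OF c] K.subgroup_axioms by blast
  then have "(\<lambda>d. tensor_class R M' N' (?h d)) ` tensor_class R M N c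
      = {tensor_class R M' N' (?h c)}"
    using const by blast
  then show ?thesis by (simp add: tensor_map_def)
qed

end

(* For A in a two-sided ideal I, the diagonal matrix of the column sums of |A| lies in I: it is the
   diagonal of U A with U the transposed matrix of conjugate signs of A, and the diagonal of an
   element of I is a finite sum of compressions to the colour classes of a colouring that separates
   the indices of its nonzero off-diagonal entries. If e is a nonnegative diagonal matrix in I that
   dominates these column sums, then A = (A/e) e with A/e in the ring. As a left module, I is thus
   the directed union of the cyclic modules generated by such e, and these are projective, being
   isomorphic to the one generated by the support projection of e. The directed union appears below
   as a filter on the e: every element of M (x) I becomes a single tensor m (x) e, where m in M
   is the image under x (x) A |-> x (A/e), which is eventually balanced and natural in M; so an
   injective map M -> M' stays injective after tensoring with I. Transposition turns left into
   right. *)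

theory Submission
  imports Defs
begin

section \<open>Tensor kernels and injectivity of tensor maps\<close>

lemma subgroup_tensor_kernel:
  assumes "right_module R M" "left_module R N"
  shows "subgroup (tensor_kernel R M N) (free_Abelian_group (carrier M \<times> carrier N))"
  using tensor_kernel_normal[OF assms] by (rule normal_imp_subgroup)

lemma
  assumes MN: "right_module R M" "left_module R N"
  shows tensor_kernel_add: "\<lbrakk>a \<in> tensor_kernel R M N; b \<in> tensor_kernel R M N\<rbrakk> \<Longrightarrow> a + b \<in> tensor_kernel R M N"
    and tensor_kernel_minus: "a \<in> tensor_kernel R M N \<Longrightarrow> - a \<in> tensor_kernel R M N"
    and tensor_kernel_diff: "\<lbrakk>a \<in> tensor_kernel R M N; b \<in> tensor_kernel R M N\<rbrakk> \<Longrightarrow> a - b \<in> tensor_kernel R M N"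
proof -
  interpret K: subgroup "tensor_kernel R M N" "free_Abelian_group (carrier M \<times> carrier N)"
    by (rule subgroup_tensor_kernel[OF MN])
  show add: "a + b \<in> tensor_kernel R M N" if "a \<in> tensor_kernel R M N" "b \<in> tensor_kernel R M N" for a b
    using K.m_closed[OF that] by simp
  show minus: "- a \<in> tensor_kernel R M N" if "a \<in> tensor_kernel R M N" for a
    using K.m_inv_closed[OF that] K.mem_carrier[OF that] by simp
  show "a - b \<in> tensor_kernel R M N" if "a \<in> tensor_kernel R M N" "b \<in> tensor_kernel R M N"
    using add[OF that(1) minus[OF that(2)]] by simp
qed

lemma tensor_class_eq_iff:
  assumes MN: "right_module R M" "left_module R N"
    and c: "c \<in> carrier (free_Abelian_group (carrier M \<times> carrier N))"
    and d: "d \<in> carrier (free_Abelian_group (carrier M \<times> carrier N))"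
  shows "tensor_class R M N c = tensor_class R M N d \<longleftrightarrow> c - d \<in> tensor_kernel R M N"
proof -
  let ?F = "free_Abelian_group (carrier M \<times> carrier N)"
  interpret F: Group.group ?F by simp
  note K = subgroup_tensor_kernel[OF MN]
  have "c - d = c \<otimes>\<^bsub>?F\<^esub> inv\<^bsub>?F\<^esub> d" using d by simp
  moreover have "tensor_class R M N c = tensor_class R M N d \<longleftrightarrow> c \<in> tensor_class R M N d"
    unfolding tensor_class_def
    using F.repr_independence[OF _ d K] F.rcos_self[OF c K] by metis
  ultimately show ?thesis
    using subgroup.rcos_module[OF K F.is_group d c] by (simp only: tensor_class_def)
qed

lemma frag_extend_module_homs_closed:
  assumes f: "f \<in> module_homs R M M'" and g: "g \<in> module_homs R N N'"
    and c: "c \<in> carrier (free_Abelian_group (carrier M \<times> carrier N))"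
  shows "frag_extend (\<lambda>(x, y). frag_of (f x, g y)) c
    \<in> carrier (free_Abelian_group (carrier M' \<times> carrier N'))"
proof -
  have "Poly_Mapping.keys (frag_extend (\<lambda>(x, y). frag_of (f x, g y)) c)
      \<subseteq> (\<Union>x\<in>Poly_Mapping.keys c. Poly_Mapping.keys (case x of (x, y) \<Rightarrow> frag_of (f x, g y)))"
    by (rule keys_frag_extend)
  also have "\<dots> \<subseteq> carrier M' \<times> carrier N'"
    using assms by (fastforce simp: module_homs_def Pi_iff split: if_splits)
  finally show ?thesis by simp
qed

text \<open>Every element of the tensor product is the class of a formal sum, and two classes agree
  exactly when the difference lies in the tensor kernel. This moves injectivity from cosets to
  formal sums, where only the kernel has to be tested.\<close>

lemma inj_on_tensor_mapI:
  assumes MN: "right_module R M" "left_module R N"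
    and MN': "right_module R M'" "left_module R N'"
    and f: "f \<in> module_homs R M M'" and g: "g \<in> module_homs R N N'"
    and ker: "\<And>c. \<lbrakk>c \<in> carrier (free_Abelian_group (carrier M \<times> carrier N));
        frag_extend (\<lambda>(x, y). frag_of (f x, g y)) c \<in> tensor_kernel R M' N'\<rbrakk> \<Longrightarrow>
        c \<in> tensor_kernel R M N"
  shows "inj_on (tensor_map R M' N' f g) (carrier (tensor_product R M N))"
proof (rule inj_onI)
  let ?F = "free_Abelian_group (carrier M \<times> carrier N)"
  let ?h = "frag_extend (\<lambda>(x, y). frag_of (f x, g y))"
  fix S T
  assume ST: "S \<in> carrier (tensor_product R M N)" "T \<in> carrier (tensor_product R M N)"
    and eq: "tensor_map R M' N' f g S = tensor_map R M' N' f g T"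
  have "\<exists>c\<in>carrier ?F. U = tensor_class R M N c" if "U \<in> carrier (tensor_product R M N)" for U
    using that by (auto simp: tensor_product_def FactGroup_def RCOSETS_def tensor_class_def)
  then obtain c d where c: "c \<in> carrier ?F" "S = tensor_class R M N c"
    and d: "d \<in> carrier ?F" "T = tensor_class R M N d" using ST by meson
  note h = frag_extend_module_homs_closed[OF f g]
  have "?h c - ?h d \<in> tensor_kernel R M' N'"
    using eq unfolding c(2) d(2) tensor_map_class[OF MN MN' f g c(1)] tensor_map_class[OF MN MN' f g d(1)]
      tensor_class_eq_iff[OF MN' h[OF c(1)] h[OF d(1)]] .
  moreover have "c - d \<in> carrier ?F"
    using c d keys_diff[of c d] by auto
  ultimately have "c - d \<in> tensor_kernel R M N"
    using ker by (simp add: frag_extend_diff)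
  then show "S = T" using tensor_class_eq_iff[OF MN c(1) d(1)] c d by simp
qed

section \<open>An injectivity criterion along a filter\<close>

text \<open>\<open>\<phi>'\<close> has to respect each relator only eventually, which suffices because an element of the
  tensor kernel involves finitely many relators.\<close>

lemma inj_on_tensor_map_if_eventually_simple:
  fixes F :: "'i filter"
    and P :: "('p, 'q) ring_scheme" and P' :: "('r, 's) ring_scheme"
  assumes MN: "right_module R M" "left_module R N"
    and MN': "right_module R M'" "left_module R N'"
    and f: "f \<in> module_homs R M M'" and g: "g \<in> module_homs R N N'"
    and P: "abelian_group P" and P': "abelian_group P'"
    and j: "j \<in> hom (add_monoid P) (add_monoid P')" "inj_on j (carrier P)"
    and F: "F \<noteq> bot"
    and \<phi>: "\<And>i x y. \<lbrakk>x \<in> carrier M; y \<in> carrier N\<rbrakk> \<Longrightarrow> \<phi> i x y \<in> carrier P"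
    and \<phi>': "\<And>i x y. \<lbrakk>x \<in> carrier M'; y \<in> carrier N'\<rbrakk> \<Longrightarrow> \<phi>' i x y \<in> carrier P'"
    and comm: "\<And>i x y. \<lbrakk>x \<in> carrier M; y \<in> carrier N\<rbrakk> \<Longrightarrow> j (\<phi> i x y) = \<phi>' i (f x) (g y)"
    and \<phi>'_add_l: "\<And>x x' y. \<lbrakk>x \<in> carrier M'; x' \<in> carrier M'; y \<in> carrier N'\<rbrakk> \<Longrightarrow>
        \<forall>\<^sub>F i in F. \<phi>' i (x \<oplus>\<^bsub>M'\<^esub> x') y = \<phi>' i x y \<oplus>\<^bsub>P'\<^esub> \<phi>' i x' y"
    and \<phi>'_add_r: "\<And>x y y'. \<lbrakk>x \<in> carrier M'; y \<in> carrier N'; y' \<in> carrier N'\<rbrakk> \<Longrightarrow>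
        \<forall>\<^sub>F i in F. \<phi>' i x (y \<oplus>\<^bsub>N'\<^esub> y') = \<phi>' i x y \<oplus>\<^bsub>P'\<^esub> \<phi>' i x y'"
    and \<phi>'_bal: "\<And>a x y. \<lbrakk>a \<in> carrier R; x \<in> carrier M'; y \<in> carrier N'\<rbrakk> \<Longrightarrow>
        \<forall>\<^sub>F i in F. \<phi>' i (a \<odot>\<^bsub>M'\<^esub> x) y = \<phi>' i x (a \<odot>\<^bsub>N'\<^esub> y)"
    and \<tau>_add: "\<forall>\<^sub>F i in F. \<forall>p\<in>carrier P. \<forall>p'\<in>carrier P.
        frag_of (\<tau> i (p \<oplus>\<^bsub>P\<^esub> p')) - frag_of (\<tau> i p) - frag_of (\<tau> i p') \<in> tensor_kernel R M N"
    and \<tau>_\<phi>: "\<And>x y. \<lbrakk>x \<in> carrier M; y \<in> carrier N\<rbrakk> \<Longrightarrow>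
        \<forall>\<^sub>F i in F. frag_of (x, y) - frag_of (\<tau> i (\<phi> i x y)) \<in> tensor_kernel R M N"
  shows "inj_on (tensor_map R M' N' f g) (carrier (tensor_product R M N))"
proof (rule inj_on_tensor_mapI[OF MN MN' f g])
  let ?F = "free_Abelian_group (carrier M \<times> carrier N)"
  let ?F' = "free_Abelian_group (carrier M' \<times> carrier N')"
  let ?h = "frag_extend (\<lambda>(x, y). frag_of (f x, g y))"
  note add = tensor_kernel_add[OF MN] and sub = tensor_kernel_diff[OF MN]
    and minus = tensor_kernel_minus[OF MN]
  interpret P: abelian_group P by fact
  interpret P': abelian_group P' by fact
  interpret M': right_module R M' by fact
  interpret N': left_module R N' by fact
  \<comment> \<open>\<open>H i\<close> extends \<open>\<phi> i\<close> additively to formal sums,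
    and \<open>\<tau> i\<close> goes back by sending an element of \<open>P\<close> to a single
    pair. For late \<open>i\<close>, \<open>c\<close> will be congruent to
    \<open>frag_of (\<tau> i (H i c))\<close>, so that one element of \<open>P\<close> controls the
    whole formal sum.\<close>
  have "\<exists>H. H \<in> hom ?F (add_monoid P) \<and> (\<forall>x\<in>carrier M. \<forall>y\<in>carrier N. H (frag_of (x, y)) = \<phi> i x y)" for i
    by (rule P.a_comm_group[THEN comm_group.free_Abelian_group_universal,
          of "\<lambda>(x, y). \<phi> i x y" "carrier M \<times> carrier N"]) (use \<phi> in auto)
  then obtain H where H: "\<And>i. H i \<in> hom ?F (add_monoid P)"
    and H_of: "\<And>i x y. \<lbrakk>x \<in> carrier M; y \<in> carrier N\<rbrakk> \<Longrightarrow> H i (frag_of (x, y)) = \<phi> i x y"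
    by metis
  have "\<exists>H. H \<in> hom ?F' (add_monoid P') \<and> (\<forall>x\<in>carrier M'. \<forall>y\<in>carrier N'. H (frag_of (x, y)) = \<phi>' i x y)" for i
    by (rule P'.a_comm_group[THEN comm_group.free_Abelian_group_universal,
          of "\<lambda>(x, y). \<phi>' i x y" "carrier M' \<times> carrier N'"]) (use \<phi>' in auto)
  then obtain H' where H': "\<And>i. H' i \<in> hom ?F' (add_monoid P')"
    and H'_of: "\<And>i x y. \<lbrakk>x \<in> carrier M'; y \<in> carrier N'\<rbrakk> \<Longrightarrow> H' i (frag_of (x, y)) = \<phi>' i x y"
    by metis
  interpret H: group_hom ?F "add_monoid P" "H i" for i
    by (intro group_hom.intro group_hom_axioms.intro H) (auto intro: P.a_group)
  interpret H': group_hom ?F' "add_monoid P'" "H' i" for i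
    by (intro group_hom.intro group_hom_axioms.intro H') (auto intro: P'.a_group)
  interpret j: group_hom "add_monoid P" "add_monoid P'" j
    by (intro group_hom.intro group_hom_axioms.intro j) (auto intro: P.a_group P'.a_group)
  note h = frag_extend_module_homs_closed[OF f g]
  have dF: "c - d \<in> carrier ?F" "c - d = c \<otimes>\<^bsub>?F\<^esub> inv\<^bsub>?F\<^esub> d"
    if "c \<in> carrier ?F" "d \<in> carrier ?F" for c d
    using that keys_diff[of c d] by auto
  have dF': "c - d \<in> carrier ?F'" "c - d = c \<otimes>\<^bsub>?F'\<^esub> inv\<^bsub>?F'\<^esub> d"
    if "c \<in> carrier ?F'" "d \<in> carrier ?F'" for c d
    using that keys_diff[of c d] by auto
  have H_closed: "H i c \<in> carrier P" if "c \<in> carrier ?F" for c i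
    using H.hom_closed[OF that] by simp
  have H'_closed: "H' i c \<in> carrier P'" if "c \<in> carrier ?F'" for c i
    using H'.hom_closed[OF that] by simp
  have H_diff: "H i (c - d) = H i c \<ominus>\<^bsub>P\<^esub> H i d" if "c \<in> carrier ?F" "d \<in> carrier ?F" for c d i
    by (simp only: dF(2)[OF that] H.hom_mult[OF that(1) H.G.inv_closed[OF that(2)]] H.hom_inv[OF that(2)])
      (simp add: a_minus_def a_inv_def)
  have H'_diff: "H' i (c - d) = H' i c \<ominus>\<^bsub>P'\<^esub> H' i d" if "c \<in> carrier ?F'" "d \<in> carrier ?F'" for c d i
    by (simp only: dF'(2)[OF that] H'.hom_mult[OF that(1) H'.G.inv_closed[OF that(2)]] H'.hom_inv[OF that(2)])
      (simp add: a_minus_def a_inv_def)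
  have H_zero: "H i 0 = \<zero>\<^bsub>P\<^esub>" for i using H.hom_one[of i] by simp
  have H'_zero: "H' i 0 = \<zero>\<^bsub>P'\<^esub>" for i using H'.hom_one[of i] by simp
  have j_diff: "j (p \<ominus>\<^bsub>P\<^esub> p') = j p \<ominus>\<^bsub>P'\<^esub> j p'" if "p \<in> carrier P" "p' \<in> carrier P" for p p'
    using j.hom_mult[of p "\<ominus>\<^bsub>P\<^esub> p'"] j.hom_inv[of p'] that
    by (simp add: a_minus_def a_inv_def)
  have j_zero: "j \<zero>\<^bsub>P\<^esub> = \<zero>\<^bsub>P'\<^esub>" using j.hom_one by simp

  \<comment> \<open>When both summands are zero, the expression in \<open>\<tau>_add\<close>
    collapses to minus the generator at \<open>\<tau> i\<close> of zero.\<close>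
  have \<tau>_zero: "\<forall>\<^sub>F i in F. frag_of (\<tau> i \<zero>\<^bsub>P\<^esub>) \<in> tensor_kernel R M N"
    using \<tau>_add by eventually_elim (use minus in fastforce)
  have reduce: "\<forall>\<^sub>F i in F. c - frag_of (\<tau> i (H i c)) \<in> tensor_kernel R M N"
    if "c \<in> carrier ?F" for c
    using that unfolding carrier_free_Abelian_group_iff
  proof (induction c rule: free_Abelian_group_induct[consumes 1, case_names zero diff of])
    case zero
    show ?case using \<tau>_zero by eventually_elim (simp add: H_zero minus)
  next
    case (diff c d)
    then have cd: "c \<in> carrier ?F" "d \<in> carrier ?F" by auto
    show ?case using diff.IH \<tau>_add
    proof eventually_elim
      case (elim i)
      \<comment> \<open>The induction forms differences while \<open>\<tau>_add\<close> speaks of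
        sums, so \<open>H i c\<close> is split as the difference of \<open>H i c\<close> and
        \<open>H i d\<close>, plus \<open>H i d\<close>. Adding \<open>?u\<close> then replaces two
        pairs by one.\<close>
      let ?u = "frag_of (\<tau> i (H i c)) - frag_of (\<tau> i (H i c \<ominus>\<^bsub>P\<^esub> H i d)) - frag_of (\<tau> i (H i d))"
      have "H i c = (H i c \<ominus>\<^bsub>P\<^esub> H i d) \<oplus>\<^bsub>P\<^esub> H i d"
        using H_closed cd by (simp add: a_minus_def P.a_assoc P.l_neg)
      then have "?u \<in> tensor_kernel R M N"
        using elim(3) H_closed cd P.minus_closed by metis
      then have "(c - frag_of (\<tau> i (H i c))) - (d - frag_of (\<tau> i (H i d))) + ?u \<in> tensor_kernel R M N"
        by (rule add[OF sub[OF elim(1,2)]])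
      then show ?case by (simp add: H_diff[OF cd])
    qed
  next
    case (of a)
    then show ?case using \<tau>_\<phi> by (cases a) (simp add: H_of)
  qed
  \<comment> \<open>On generators this is \<open>comm\<close>; both sides are additive in
    \<open>c\<close>.\<close>
  have comm': "H' i (?h c) = j (H i c)" if "c \<in> carrier ?F" for c i
    using that unfolding carrier_free_Abelian_group_iff
  proof (induction c rule: free_Abelian_group_induct[consumes 1, case_names zero diff of])
    case zero
    show ?case by (simp add: H_zero H'_zero j_zero)
  next
    case (diff c d)
    then have cd: "c \<in> carrier ?F" "d \<in> carrier ?F" by auto
    then show ?case using diff.IH
      by (simp add: frag_extend_diff H_diff H'_diff h j_diff H_closed del: carrier_free_Abelian_group_iff)
  next
    case (of a)
    moreover have "f (fst a) \<in> carrier M'" "g (snd a) \<in> carrier N'"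
      using f g of by (auto simp: module_homs_def)
    ultimately show ?case by (cases a) (simp add: H_of H'_of comm)
  qed
  have of: "frag_of (x, y) \<in> carrier ?F'" if "x \<in> carrier M'" "y \<in> carrier N'" for x y
    using that by simp
  have rel: "\<forall>\<^sub>F i in F. H' i r = \<zero>\<^bsub>P'\<^esub>" if "r \<in> tensor_relators R M' N'" for r
  proof -
    consider
      (add_l) x x' y where "r = frag_of (x \<oplus>\<^bsub>M'\<^esub> x', y) - frag_of (x, y) - frag_of (x', y)"
        "x \<in> carrier M'" "x' \<in> carrier M'" "y \<in> carrier N'"
    | (add_r) x y y' where "r = frag_of (x, y \<oplus>\<^bsub>N'\<^esub> y') - frag_of (x, y) - frag_of (x, y')"
        "x \<in> carrier M'" "y \<in> carrier N'" "y' \<in> carrier N'"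
    | (bal) a x y where "r = frag_of (a \<odot>\<^bsub>M'\<^esub> x, y) - frag_of (x, a \<odot>\<^bsub>N'\<^esub> y)"
        "a \<in> carrier R" "x \<in> carrier M'" "y \<in> carrier N'"
      using \<open>r \<in> tensor_relators R M' N'\<close> unfolding tensor_relators_def by blast
    then show ?thesis
    proof cases
      case add_l
      note xy = add_l(2-4)
      show ?thesis using \<phi>'_add_l[OF xy]
      proof eventually_elim
        case (elim i)
        have "H' i r = \<phi>' i (x \<oplus>\<^bsub>M'\<^esub> x') y \<ominus>\<^bsub>P'\<^esub> \<phi>' i x y \<ominus>\<^bsub>P'\<^esub> \<phi>' i x' y"
          using xy by (simp add: add_l(1) H'_diff H'_of dF'(1) of del: carrier_free_Abelian_group_iff)
        also have "\<dots> = \<zero>\<^bsub>P'\<^esub>"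
          using \<phi>' xy by (simp add: elim a_minus_def P'.minus_add P'.a_ac P'.r_neg P'.r_neg1 P'.r_neg2)
        finally show ?case .
      qed
    next
      case add_r
      note xy = add_r(2-4)
      show ?thesis using \<phi>'_add_r[OF xy]
      proof eventually_elim
        case (elim i)
        have "H' i r = \<phi>' i x (y \<oplus>\<^bsub>N'\<^esub> y') \<ominus>\<^bsub>P'\<^esub> \<phi>' i x y \<ominus>\<^bsub>P'\<^esub> \<phi>' i x y'"
          using xy by (simp add: add_r(1) H'_diff H'_of dF'(1) of del: carrier_free_Abelian_group_iff)
        also have "\<dots> = \<zero>\<^bsub>P'\<^esub>"
          using \<phi>' xy by (simp add: elim a_minus_def P'.minus_add P'.a_ac P'.r_neg P'.r_neg1 P'.r_neg2)
        finally show ?case .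
      qed
    next
      case bal
      note axy = bal(2-4)
      show ?thesis using \<phi>'_bal[OF axy]
      proof eventually_elim
        case (elim i)
        have cl: "a \<odot>\<^bsub>M'\<^esub> x \<in> carrier M'" "a \<odot>\<^bsub>N'\<^esub> y \<in> carrier N'"
          using M'.rsmult_closed N'.lsmult_closed axy by auto
        have "H' i r = \<phi>' i x (a \<odot>\<^bsub>N'\<^esub> y) \<ominus>\<^bsub>P'\<^esub> \<phi>' i x (a \<odot>\<^bsub>N'\<^esub> y)"
          unfolding bal(1) H'_diff[OF of[OF cl(1) axy(3)] of[OF axy(2) cl(2)]]
            H'_of[OF cl(1) axy(3)] H'_of[OF axy(2) cl(2)] elim ..
        then show ?case using \<phi>'[OF axy(2) cl(2), of i] by (simp add: a_minus_def P'.r_neg)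
      qed
    qed
  qed
  note rel_carrier = tensor_relators_subset[OF MN', THEN subsetD]
  \<comment> \<open>The \<open>eng\<close> case intersects two eventual conditions; this is how
    eventual vanishing on relators passes to everything they generate.\<close>
  have kernel: "\<forall>\<^sub>F i in F. H' i k = \<zero>\<^bsub>P'\<^esub>" if "k \<in> tensor_kernel R M' N'" for k
    using that unfolding tensor_kernel_def
  proof (induction k rule: generate.induct)
    case one
    then show ?case by (simp add: H'_zero)
  next
    case (incl r)
    then show ?case by (rule rel)
  next
    case (inv r)
    have "H' i (inv\<^bsub>?F'\<^esub> r) = \<ominus>\<^bsub>P'\<^esub> H' i r" for i
      using H'.hom_inv[OF rel_carrier[OF inv]] by (simp only: a_inv_def)
    then show ?case using rel[OF inv] by (auto elim: eventually_mono)
  next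
    case (eng k k')
    have "k \<in> carrier ?F'" "k' \<in> carrier ?F'"
      using eng subgroup.mem_carrier[OF subgroup_tensor_kernel[OF MN']] unfolding tensor_kernel_def by auto
    note mult = H'.hom_mult[OF this]
    show ?case using eng.IH by eventually_elim (simp only: mult, simp)
  qed

  fix c
  assume c: "c \<in> carrier ?F" and hc: "?h c \<in> tensor_kernel R M' N'"
  \<comment> \<open>As \<open>?h c\<close> lies in the kernel, \<open>j (H i c)\<close> is zero for
    late \<open>i\<close>, hence so is \<open>H i c\<close>. Then \<open>c\<close> is congruent to
    the generator of \<open>\<tau>_zero\<close>, itself in the kernel.\<close>
  have "\<forall>\<^sub>F i in F. c \<in> tensor_kernel R M N"
    using reduce[OF c] kernel[OF hc] \<tau>_zero
  proof eventually_elim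
    case (elim i)
    have "j (H i c) = j \<zero>\<^bsub>P\<^esub>" using elim(2) comm'[OF c] j_zero by simp
    then have "H i c = \<zero>\<^bsub>P\<^esub>" using j(2) H_closed[OF c] by (auto dest: inj_onD)
    then show ?case using add[OF elim(1,3)] by simp
  qed
  \<comment> \<open>The claim no longer mentions \<open>i\<close>, so on a proper filter holding
    eventually means holding.\<close>
  then show "c \<in> tensor_kernel R M N" using F by (simp add: eventually_const_iff)
qed

section \<open>Flatness of ideals that are eventually cyclic\<close>

lemma
  shows tensor_kernel_add_left: "\<lbrakk>x \<in> carrier M; x' \<in> carrier M; y \<in> carrier N\<rbrakk> \<Longrightarrow>
      frag_of (x \<oplus>\<^bsub>M\<^esub> x', y) - frag_of (x, y) - frag_of (x', y) \<in> tensor_kernel R M N"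
    and tensor_kernel_add_right: "\<lbrakk>x \<in> carrier M; y \<in> carrier N; y' \<in> carrier N\<rbrakk> \<Longrightarrow>
      frag_of (x, y \<oplus>\<^bsub>N\<^esub> y') - frag_of (x, y) - frag_of (x, y') \<in> tensor_kernel R M N"
    and tensor_kernel_balanced: "\<lbrakk>a \<in> carrier R; x \<in> carrier M; y \<in> carrier N\<rbrakk> \<Longrightarrow>
      frag_of (a \<odot>\<^bsub>M\<^esub> x, y) - frag_of (x, a \<odot>\<^bsub>N\<^esub> y) \<in> tensor_kernel R M N"
  unfolding tensor_kernel_def
  by (rule generate.incl; unfold tensor_relators_def; blast)+

lemma module_homs_id: "id \<in> module_homs R M M"
  by (simp add: module_homs_def)

lemma module_homs_imp_hom: "f \<in> module_homs R M N \<Longrightarrow> f \<in> hom (add_monoid M) (add_monoid N)"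
  by (auto simp: module_homs_def hom_def)

text \<open>Read \<open>q i x\<close> as \<open>x\<close> divided on the right by
  \<open>d i\<close>. Balancing turns the tensor of \<open>m\<close> and \<open>x\<close> into that
  of \<open>m (q i x)\<close> and \<open>d i\<close>, so the test module itself serves as
  \<open>P\<close> and the given injection as \<open>j\<close>. Each \<open>i\<close> has to serve
  only finitely many elements of \<open>I\<close> at a time, so eventual identities suffice.\<close>

lemma flat_left_module_left_ideal_if_eventually_cyclic:
  fixes R :: "('a, 'r) ring_scheme" and F :: "'i filter"
  assumes I: "left_module R (left_ideal_module R I)" "I \<subseteq> carrier R"
    and F: "F \<noteq> bot"
    and d: "\<forall>\<^sub>F i in F. d i \<in> I"
    and q: "\<And>i x. x \<in> I \<Longrightarrow> q i x \<in> carrier R"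
    and q_d: "\<And>x. x \<in> I \<Longrightarrow> \<forall>\<^sub>F i in F. q i x \<otimes>\<^bsub>R\<^esub> d i = x"
    and q_add: "\<And>x y. \<lbrakk>x \<in> I; y \<in> I\<rbrakk> \<Longrightarrow> \<forall>\<^sub>F i in F. q i (x \<oplus>\<^bsub>R\<^esub> y) = q i x \<oplus>\<^bsub>R\<^esub> q i y"
    and q_mult: "\<And>a x. \<lbrakk>a \<in> carrier R; x \<in> I\<rbrakk> \<Longrightarrow> \<forall>\<^sub>F i in F. q i (a \<otimes>\<^bsub>R\<^esub> x) = a \<otimes>\<^bsub>R\<^esub> q i x"
  shows "flat_left_module TYPE('m) TYPE('n) R (left_ideal_module R I)"
  unfolding flat_left_module_def
proof (intro conjI allI impI; (elim conjE)?)
  fix A :: "('a, 'm) module" and B :: "('a, 'n) module" and f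
  assume A: "right_module R A" and B: "right_module R B"
    and f: "f \<in> module_homs R A B" "inj_on f (carrier A)"
  let ?I = "left_ideal_module R I"
  interpret A: right_module R A by fact
  interpret B: right_module R B by fact
  have I_simps: "carrier ?I = I" "x \<oplus>\<^bsub>?I\<^esub> y = x \<oplus>\<^bsub>R\<^esub> y" "a \<odot>\<^bsub>?I\<^esub> x = a \<otimes>\<^bsub>R\<^esub> x" for a x y
    by (simp_all add: left_ideal_module_def)
  show "inj_on (tensor_map R B ?I f id) (carrier (tensor_product R A ?I))"
  proof (rule inj_on_tensor_map_if_eventually_simple[OF A I(1) B I(1) f(1) module_homs_id
          A.abelian_group_axioms B.abelian_group_axioms module_homs_imp_hom[OF f(1)] f(2) F,
          where \<phi> = "\<lambda>i x y. q i y \<odot>\<^bsub>A\<^esub> x" and \<phi>' = "\<lambda>i x y. q i y \<odot>\<^bsub>B\<^esub> x"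
            and \<tau> = "\<lambda>i p. (p, d i)"], unfold I_simps)
    show "f (q i y \<odot>\<^bsub>A\<^esub> x) = q i (id y) \<odot>\<^bsub>B\<^esub> f x" if "x \<in> carrier A" "y \<in> I" for i x y
      using f(1) q that by (simp add: module_homs_def)
    show "\<forall>\<^sub>F i in F. q i (y \<oplus>\<^bsub>R\<^esub> y') \<odot>\<^bsub>B\<^esub> x = q i y \<odot>\<^bsub>B\<^esub> x \<oplus>\<^bsub>B\<^esub> q i y' \<odot>\<^bsub>B\<^esub> x"
      if "x \<in> carrier B" "y \<in> I" "y' \<in> I" for x y y'
      using q_add[OF that(2,3)] by eventually_elim (use that q in \<open>simp add: B.rsmult_l_distr\<close>)
    show "\<forall>\<^sub>F i in F. q i y \<odot>\<^bsub>B\<^esub> (a \<odot>\<^bsub>B\<^esub> x) = q i (a \<otimes>\<^bsub>R\<^esub> y) \<odot>\<^bsub>B\<^esub> x"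
      if "a \<in> carrier R" "x \<in> carrier B" "y \<in> I" for a x y
      using q_mult[OF that(1,3)] by eventually_elim (use that q in \<open>simp add: B.rsmult_assoc\<close>)
    show "\<forall>\<^sub>F i in F. \<forall>p\<in>carrier A. \<forall>p'\<in>carrier A.
        frag_of (p \<oplus>\<^bsub>A\<^esub> p', d i) - frag_of (p, d i) - frag_of (p', d i) \<in> tensor_kernel R A ?I"
      using d by eventually_elim (use tensor_kernel_add_left[of _ A _ _ ?I R] in \<open>simp add: I_simps\<close>)
    show "\<forall>\<^sub>F i in F. frag_of (x, y) - frag_of (q i y \<odot>\<^bsub>A\<^esub> x, d i) \<in> tensor_kernel R A ?I"
      if "x \<in> carrier A" "y \<in> I" for x y
      using d q_d[OF that(2)]
    proof eventually_elim
      case (elim i)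
      show ?case
        using tensor_kernel_minus[OF A I(1) tensor_kernel_balanced[of "q i y" R x A "d i" ?I]]
          elim that q by (simp add: I_simps)
    qed
  qed (use q A.rsmult_closed B.rsmult_closed B.rsmult_r_distr in auto)
qed (rule I)

text \<open>Mirror image of the previous lemma: \<open>d i\<close> now stands on the left, and
  balancing moves the quotient \<open>q i x\<close> across the tensor sign into the left test
  module.\<close>

lemma flat_right_module_right_ideal_if_eventually_cyclic:
  fixes R :: "('a, 'r) ring_scheme" and F :: "'i filter"
  assumes I: "right_module R (right_ideal_module R I)" "I \<subseteq> carrier R"
    and F: "F \<noteq> bot"
    and d: "\<forall>\<^sub>F i in F. d i \<in> I"
    and q: "\<And>i x. x \<in> I \<Longrightarrow> q i x \<in> carrier R"
    and d_q: "\<And>x. x \<in> I \<Longrightarrow> \<forall>\<^sub>F i in F. d i \<otimes>\<^bsub>R\<^esub> q i x = x"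
    and q_add: "\<And>x y. \<lbrakk>x \<in> I; y \<in> I\<rbrakk> \<Longrightarrow> \<forall>\<^sub>F i in F. q i (x \<oplus>\<^bsub>R\<^esub> y) = q i x \<oplus>\<^bsub>R\<^esub> q i y"
    and q_mult: "\<And>a x. \<lbrakk>a \<in> carrier R; x \<in> I\<rbrakk> \<Longrightarrow> \<forall>\<^sub>F i in F. q i (x \<otimes>\<^bsub>R\<^esub> a) = q i x \<otimes>\<^bsub>R\<^esub> a"
  shows "flat_right_module TYPE('m) TYPE('n) R (right_ideal_module R I)"
  unfolding flat_right_module_def
proof (intro conjI allI impI; (elim conjE)?)
  fix A :: "('a, 'm) module" and B :: "('a, 'n) module" and f
  assume A: "left_module R A" and B: "left_module R B"
    and f: "f \<in> module_homs R A B" "inj_on f (carrier A)"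
  let ?I = "right_ideal_module R I"
  interpret A: left_module R A by fact
  interpret B: left_module R B by fact
  have I_simps: "carrier ?I = I" "x \<oplus>\<^bsub>?I\<^esub> y = x \<oplus>\<^bsub>R\<^esub> y" "a \<odot>\<^bsub>?I\<^esub> x = x \<otimes>\<^bsub>R\<^esub> a" for a x y
    by (simp_all add: right_ideal_module_def)
  show "inj_on (tensor_map R ?I B id f) (carrier (tensor_product R ?I A))"
  proof (rule inj_on_tensor_map_if_eventually_simple[OF I(1) A I(1) B module_homs_id f(1)
          A.abelian_group_axioms B.abelian_group_axioms module_homs_imp_hom[OF f(1)] f(2) F,
          where \<phi> = "\<lambda>i x y. q i x \<odot>\<^bsub>A\<^esub> y" and \<phi>' = "\<lambda>i x y. q i x \<odot>\<^bsub>B\<^esub> y"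
            and \<tau> = "\<lambda>i p. (d i, p)"], unfold I_simps)
    show "f (q i x \<odot>\<^bsub>A\<^esub> y) = q i (id x) \<odot>\<^bsub>B\<^esub> f y" if "x \<in> I" "y \<in> carrier A" for i x y
      using f(1) q that by (simp add: module_homs_def)
    show "\<forall>\<^sub>F i in F. q i (x \<oplus>\<^bsub>R\<^esub> x') \<odot>\<^bsub>B\<^esub> y = q i x \<odot>\<^bsub>B\<^esub> y \<oplus>\<^bsub>B\<^esub> q i x' \<odot>\<^bsub>B\<^esub> y"
      if "x \<in> I" "x' \<in> I" "y \<in> carrier B" for x x' y
      using q_add[OF that(1,2)] by eventually_elim (use that q in \<open>simp add: B.lsmult_l_distr\<close>)
    show "\<forall>\<^sub>F i in F. q i (x \<otimes>\<^bsub>R\<^esub> a) \<odot>\<^bsub>B\<^esub> y = q i x \<odot>\<^bsub>B\<^esub> (a \<odot>\<^bsub>B\<^esub> y)"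
      if "a \<in> carrier R" "x \<in> I" "y \<in> carrier B" for a x y
      using q_mult[OF that(1,2)] by eventually_elim (use that q in \<open>simp add: B.lsmult_assoc\<close>)
    show "\<forall>\<^sub>F i in F. \<forall>p\<in>carrier A. \<forall>p'\<in>carrier A.
        frag_of (d i, p \<oplus>\<^bsub>A\<^esub> p') - frag_of (d i, p) - frag_of (d i, p') \<in> tensor_kernel R ?I A"
      using d by eventually_elim (use tensor_kernel_add_right[of _ ?I _ A _ R] in \<open>simp add: I_simps\<close>)
    show "\<forall>\<^sub>F i in F. frag_of (x, y) - frag_of (d i, q i x \<odot>\<^bsub>A\<^esub> y) \<in> tensor_kernel R ?I A"
      if "x \<in> I" "y \<in> carrier A" for x y
      using d d_q[OF that(1)]
    proof eventually_elim
      case (elim i)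
      show ?case
        using tensor_kernel_balanced[of "q i x" R "d i" ?I y A] elim that q
        by (simp add: I_simps)
    qed
  qed (use q A.lsmult_closed B.lsmult_closed B.lsmult_r_distr in auto)
qed (rule I)

section \<open>Greedy colouring of graphs of bounded degree\<close>

text \<open>The bounded quantifier over \<open>{..<n}\<close> supplies \<open>m < n\<close> for the
  termination of the recursion.\<close>

fun greedy_colouring :: "(nat \<Rightarrow> nat \<Rightarrow> bool) \<Rightarrow> nat \<Rightarrow> nat" where
  "greedy_colouring E n = (LEAST c. \<forall>m\<in>{..<n}. E m n \<longrightarrow> greedy_colouring E m \<noteq> c)"

declare greedy_colouring.simps [simp del]

text \<open>The at most \<open>b\<close> earlier neighbours of \<open>n\<close> exclude at most
  \<open>b\<close> of the \<open>b + 1\<close> colours in \<open>{..b}\<close>, so one of these is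
  free, and the least free colour is no larger.\<close>

lemma
  assumes "card {m. m < n \<and> E m n} \<le> b"
  shows greedy_colouring_proper: "\<lbrakk>m < n; E m n\<rbrakk> \<Longrightarrow> greedy_colouring E m \<noteq> greedy_colouring E n"
    and greedy_colouring_le: "greedy_colouring E n \<le> b"
proof -
  let ?c = "greedy_colouring E" and ?S = "{m. m < n \<and> E m n}"
  let ?P = "\<lambda>c. \<forall>m\<in>{..<n}. E m n \<longrightarrow> ?c m \<noteq> c"
  have "card (?c ` ?S) < card {..b}"
    using card_image_le[of ?S ?c] assms by simp
  then have "\<not> {..b} \<subseteq> ?c ` ?S"
    using card_mono[of "?c ` ?S" "{..b}"] by auto
  then obtain c where c: "c \<le> b" "?P c" by auto
  show "?c n \<le> b"
    by (subst greedy_colouring.simps) (rule order_trans[OF Least_le[of ?P, OF c(2)] c(1)])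
  have "?P (?c n)"
    by (subst (2) greedy_colouring.simps) (rule LeastI[of ?P, OF c(2)])
  then show "\<lbrakk>m < n; E m n\<rbrakk> \<Longrightarrow> ?c m \<noteq> ?c n" by auto
qed

section \<open>Smaller supports and diagonal matrices\<close>

lemma Gamma_infty_simps:
  "carrier Gamma_infty = Gamma_infty_carrier"
  "A \<otimes>\<^bsub>Gamma_infty\<^esub> B = inf_mat_mult A B"
  "A \<oplus>\<^bsub>Gamma_infty\<^esub> B = (\<lambda>i j. A i j + B i j)"
  "\<zero>\<^bsub>Gamma_infty\<^esub> = (\<lambda>i j. 0)"
  by (simp_all add: Gamma_infty_def)

text \<open>Shrinking the support can only lower the row and column counts, so just an entry bound
  has to be supplied. This serves diagonal matrices, sign matrices and quotients alike.\<close>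

lemma Gamma_infty_carrier_subsupport:
  assumes A: "A \<in> Gamma_infty_carrier"
    and "\<And>i j. cmod (B i j) \<le> C" "\<And>i j. A i j = 0 \<Longrightarrow> B i j = 0"
  shows "B \<in> Gamma_infty_carrier"
proof -
  obtain D b where b: "\<And>i. card {j. A i j \<noteq> 0} \<le> b" "\<And>j. card {i. A i j \<noteq> 0} \<le> b"
    using Gamma_infty_carrierE[OF A] by metis
  have "{j. B i j \<noteq> 0} \<subseteq> {j. A i j \<noteq> 0}" "{j. B j i \<noteq> 0} \<subseteq> {j. A j i \<noteq> 0}" for i
    using assms(3) by auto
  then have "finite {j. B i j \<noteq> 0} \<and> card {j. B i j \<noteq> 0} \<le> b"
    "finite {j. B j i \<noteq> 0} \<and> card {j. B j i \<noteq> 0} \<le> b" for i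
    using Gamma_infty_carrierD[OF A] b by (meson card_mono finite_subset order_trans)+
  then show ?thesis unfolding Gamma_infty_carrier_def using assms(2) by blast
qed

definition diag_mat :: "(nat \<Rightarrow> complex) \<Rightarrow> nat \<Rightarrow> nat \<Rightarrow> complex" where
  "diag_mat d = (\<lambda>i j. if i = j then d i else 0)"

text \<open>The support lies in that of the identity matrix, whose membership is
  \<open>ring_simprules(6)\<close>; \<open>max C 0\<close> also bounds the zeros off the
  diagonal.\<close>

lemma diag_mat_closed: "(\<And>i. cmod (d i) \<le> C) \<Longrightarrow> diag_mat d \<in> Gamma_infty_carrier"
  by (rule Gamma_infty_carrier_subsupport[OF ring.ring_simprules(6)[OF ring_Gamma_infty, unfolded Gamma_infty_simps(1)],
      where C = "max C 0"]) (auto simp: diag_mat_def Gamma_infty_def le_max_iff_disj)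

lemma diag_mat_mult: "inf_mat_mult (diag_mat d) A i j = d i * A i j"
  by (subst inf_mat_mult_row[of "{i}"]) (auto simp: diag_mat_def)

lemma mult_diag_mat: "inf_mat_mult A (diag_mat d) i j = A i j * d j"
  by (subst inf_mat_mult_col[of "{j}"]) (auto simp: diag_mat_def)

section \<open>Diagonals and column sums inside an ideal\<close>

text \<open>An ideal is closed under finite sums, and this is where uniform sparsity enters: it
  bounds the number of colours, hence of the compressions of \<open>A\<close> by \<open>P c\<close>
  that add up to the diagonal.\<close>

lemma ideal_Gamma_infty_diagonal:
  assumes "ideal I Gamma_infty" and A: "A \<in> I"
  shows "diag_mat (\<lambda>i. A i i) \<in> I"
proof -
  interpret ideal I Gamma_infty by fact
  have A': "A \<in> Gamma_infty_carrier" using a_Hcarr[OF A] by (simp add: Gamma_infty_simps)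
  obtain C b where b: "\<And>i. card {j. A i j \<noteq> 0} \<le> b" "\<And>j. card {i. A i j \<noteq> 0} \<le> b"
    using Gamma_infty_carrierE[OF A'] by metis
  \<comment> \<open>Symmetrised, because the colouring compares an index only with earlier
    neighbours, while both \<open>A i j\<close> and \<open>A j i\<close> must be separated. The
    degree bound becomes \<open>b + b\<close>.\<close>
  define E where "E i j \<longleftrightarrow> A i j \<noteq> 0 \<or> A j i \<noteq> 0" for i j
  define col where "col = greedy_colouring E"
  have E_card: "card {m. m < n \<and> E m n} \<le> b + b" for n
  proof -
    have "card {m. m < n \<and> E m n} \<le> card ({m. A m n \<noteq> 0} \<union> {m. A n m \<noteq> 0})"
      using Gamma_infty_carrierD[OF A'] by (intro card_mono) (auto simp: E_def)
    also have "\<dots> \<le> b + b" using card_Un_le b by (meson add_mono order_trans)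
    finally show ?thesis .
  qed
  note proper = greedy_colouring_proper[of _ E, OF E_card] and le = greedy_colouring_le[of _ E, OF E_card]
  have col: "A i j = 0" if "i \<noteq> j" "col i = col j" for i j
    using proper[of i j] proper[of j i] that
    by (cases i j rule: linorder_cases) (auto simp: col_def E_def)
  define P where "P c = diag_mat (\<lambda>i. if col i = c then 1 else 0)" for c
  have P: "P c \<in> carrier Gamma_infty" for c
    unfolding P_def Gamma_infty_simps by (rule diag_mat_closed[of _ 1]) auto
  \<comment> \<open>The sum of the compressions to the colours below \<open>n\<close>, written
    entrywise.\<close>
  have "(\<lambda>i j. if col i = col j \<and> col i < n then A i j else 0) \<in> I" for n
  proof (induction n)
    case 0
    then show ?case using additive_subgroup.zero_closed[OF is_additive_subgroup] by (simp add: Gamma_infty_simps)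
  next
    case (Suc n)
    have "P n \<otimes>\<^bsub>Gamma_infty\<^esub> A \<otimes>\<^bsub>Gamma_infty\<^esub> P n \<in> I"
      by (intro I_l_closed I_r_closed A P)
    from additive_subgroup.a_closed[OF is_additive_subgroup Suc this] show ?case
      by (rule back_subst[where P = "\<lambda>X. X \<in> I"])
        (auto simp: Gamma_infty_simps fun_eq_iff P_def diag_mat_mult mult_diag_mat)
  qed
  \<comment> \<open>The colours lie in \<open>{..b + b}\<close>, so all of them are below
    \<open>Suc (b + b)\<close>; within one colour class only diagonal entries survive, by
    \<open>col\<close>.\<close>
  from this[of "Suc (b + b)"] show ?thesis
    by (rule back_subst[where P = "\<lambda>X. X \<in> I"])
      (use col le in
        \<open>auto simp: fun_eq_iff diag_mat_def col_def less_Suc_eq_le\<close>)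
qed

text \<open>A column sum dominates every modulus in its column, so this matrix can serve as a
  denominator for \<open>A\<close> that lies in \<open>I\<close> itself.\<close>

lemma ideal_Gamma_infty_column_sums:
  assumes "ideal I Gamma_infty" and A: "A \<in> I"
  shows "diag_mat (\<lambda>j. of_real (\<Sum>i | A i j \<noteq> 0. cmod (A i j))) \<in> I"
proof -
  interpret ideal I Gamma_infty by fact
  have A': "A \<in> Gamma_infty_carrier" using a_Hcarr[OF A] by (simp add: Gamma_infty_simps)
  \<comment> \<open>Chosen so that the \<open>j\<close>-th diagonal entry of the product of
    \<open>U\<close> and \<open>A\<close> sums \<open>cnj (sgn (A i j)) * A i j\<close>, that is
    \<open>cmod (A i j)\<close>, over \<open>i\<close>.\<close>
  define U where "U = (\<lambda>i j. cnj (sgn (A j i)))"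
  have "(\<lambda>i j. A j i) \<in> Gamma_infty_carrier"
    using A' by (auto simp: Gamma_infty_carrier_def)
  then have "U \<in> carrier Gamma_infty"
    unfolding Gamma_infty_simps
    by (rule Gamma_infty_carrier_subsupport[where C = 1]) (auto simp: U_def norm_sgn)
  then have UA: "inf_mat_mult U A \<in> I"
    using I_l_closed[OF A] by (simp add: Gamma_infty_simps)
  have *: "cnj (sgn z) * z = of_real (cmod z)" for z :: complex
    by (cases "z = 0") (simp_all add: sgn_eq complex_norm_square[symmetric] power2_eq_square mult.commute)
  have "inf_mat_mult U A j j = of_real (\<Sum>i | A i j \<noteq> 0. cmod (A i j))" for j
    by (subst inf_mat_mult_col[OF Gamma_infty_carrierD(2)[OF A'] order_refl]) (simp add: U_def *)
  with ideal_Gamma_infty_diagonal[OF assms(1) UA] show ?thesis by simp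
qed

section \<open>Quotients by dominating diagonals\<close>

text \<open>Division by zero gives zero, so that the quotient vanishes on the columns where \<open>e\<close> does; an
  unbounded quotient is replaced by zero.\<close>

definition column_quotient :: "(nat \<Rightarrow> real) \<Rightarrow> (nat \<Rightarrow> nat \<Rightarrow> complex) \<Rightarrow> nat \<Rightarrow> nat \<Rightarrow> complex" where
  "column_quotient e A =
    (let Q = \<lambda>i j. A i j / of_real (e j) in if Q \<in> Gamma_infty_carrier then Q else (\<lambda>i j. 0))"

lemma column_quotient_closed: "column_quotient e A \<in> carrier Gamma_infty"
  using ring.ring_simprules(2)[OF ring_Gamma_infty]
  by (simp add: column_quotient_def Gamma_infty_simps Let_def)

text \<open>Eventually means for all large enough nonnegative diagonals in \<open>I\<close>. Beyond
  the column sums of \<open>A\<close>, \<open>column_quotient e A\<close> is the genuine quotient;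
  dividing columns by fixed numbers is additive and commutes with left multiplication.\<close>

lemma ideal_Gamma_infty_eventually_cyclic:
  assumes I: "ideal I Gamma_infty"
  obtains F :: "(nat \<Rightarrow> real) filter" where
    "F \<noteq> bot"
    "\<forall>\<^sub>F e in F. diag_mat (\<lambda>j. of_real (e j)) \<in> I"
    "\<And>A. A \<in> I \<Longrightarrow> \<forall>\<^sub>F e in F.
      column_quotient e A \<otimes>\<^bsub>Gamma_infty\<^esub> diag_mat (\<lambda>j. of_real (e j)) = A"
    "\<And>A B. \<lbrakk>A \<in> I; B \<in> I\<rbrakk> \<Longrightarrow> \<forall>\<^sub>F e in F.
      column_quotient e (A \<oplus>\<^bsub>Gamma_infty\<^esub> B) = column_quotient e A \<oplus>\<^bsub>Gamma_infty\<^esub> column_quotient e B"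
    "\<And>A B. \<lbrakk>A \<in> carrier Gamma_infty; B \<in> I\<rbrakk> \<Longrightarrow> \<forall>\<^sub>F e in F.
      column_quotient e (A \<otimes>\<^bsub>Gamma_infty\<^esub> B) = A \<otimes>\<^bsub>Gamma_infty\<^esub> column_quotient e B"
proof -
  interpret ideal I Gamma_infty by fact
  note add = additive_subgroup.a_closed[OF is_additive_subgroup]
  \<comment> \<open>Nonnegativity makes \<open>u + v\<close> an upper bound of \<open>u\<close> and
    \<open>v\<close>, so \<open>D\<close> is directed and its tails form a filter base.\<close>
  define D where "D = {e :: nat \<Rightarrow> real. (\<forall>j. e j \<ge> 0) \<and> diag_mat (\<lambda>j. of_real (e j)) \<in> I}"
  define F where "F = (INF e0\<in>D. principal {e\<in>D. \<forall>j. e0 j \<le> e j})"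
  have "(\<lambda>j. 0) \<in> D"
    using additive_subgroup.zero_closed[OF is_additive_subgroup] by (simp add: D_def diag_mat_def Gamma_infty_simps cong: if_cong)
  then have "D \<noteq> {}" by blast
  have D_add: "(\<lambda>j. u j + v j) \<in> D" if "u \<in> D" "v \<in> D" for u v
  proof -
    have "diag_mat (\<lambda>j. of_real (u j)) \<oplus>\<^bsub>Gamma_infty\<^esub> diag_mat (\<lambda>j. of_real (v j)) \<in> I"
      using that by (intro add) (auto simp: D_def)
    also have "diag_mat (\<lambda>j. of_real (u j)) \<oplus>\<^bsub>Gamma_infty\<^esub> diag_mat (\<lambda>j. of_real (v j))
        = diag_mat (\<lambda>j. of_real (u j + v j))"
      by (auto simp: Gamma_infty_simps diag_mat_def fun_eq_iff)
    finally show ?thesis using that by (simp add: D_def)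
  qed
  have F: "eventually P F \<longleftrightarrow> (\<exists>e0\<in>D. \<forall>e\<in>D. (\<forall>j. e0 j \<le> e j) \<longrightarrow> P e)" for P
    unfolding F_def
  proof (subst eventually_INF_base)
    fix u v assume uv: "u \<in> D" "v \<in> D"
    then have "principal {e\<in>D. \<forall>j. u j + v j \<le> e j}
        \<le> inf (principal {e\<in>D. \<forall>j. u j \<le> e j}) (principal {e\<in>D. \<forall>j. v j \<le> e j})"
      unfolding inf_principal principal_le_iff D_def
      by (auto intro: order_trans[rotated] simp: add_increasing add_increasing2)
    then show "\<exists>w\<in>D. principal {e\<in>D. \<forall>j. w j \<le> e j}
        \<le> inf (principal {e\<in>D. \<forall>j. u j \<le> e j}) (principal {e\<in>D. \<forall>j. v j \<le> e j})"
      using D_add[OF uv] by (intro bexI[of _ "\<lambda>j. u j + v j"])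
  qed (use \<open>D \<noteq> {}\<close> in \<open>auto simp: eventually_principal\<close>)
  \<comment> \<open>The first half says that the default value zero is not in force, the second that
    nothing is lost on columns where \<open>e\<close> vanishes, since \<open>A\<close> vanishes
    there too.\<close>
  have quot: "\<forall>\<^sub>F e in F. (\<forall>i j. column_quotient e A i j = A i j / of_real (e j)) \<and>
      (\<forall>i j. column_quotient e A i j * of_real (e j) = A i j)" if A: "A \<in> I" for A
    unfolding F
  proof (intro bexI ballI impI)
    have A': "A \<in> Gamma_infty_carrier" using a_Hcarr[OF A] by (simp add: Gamma_infty_simps)
    let ?s = "\<lambda>j. \<Sum>i | A i j \<noteq> 0. cmod (A i j)"
    show "?s \<in> D" using ideal_Gamma_infty_column_sums[OF I A] by (simp add: D_def sum_nonneg)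
    fix e assume e: "e \<in> D" "\<forall>j. ?s j \<le> e j"
    have le: "cmod (A i j) \<le> e j" for i j
    proof (cases "A i j = 0")
      case False
      then have "cmod (A i j) \<le> ?s j"
        using Gamma_infty_carrierD(2)[OF A'] by (intro member_le_sum) auto
      then show ?thesis using e(2) order_trans by blast
    qed (use e in \<open>auto simp: D_def\<close>)
    \<comment> \<open>Where \<open>e j = 0\<close> the quotient is zero by convention, so the bound
      holds there as well.\<close>
    have "cmod (A i j / of_real (e j)) \<le> 1" for i j
      using le[of i j] e(1) by (auto simp: norm_divide D_def divide_le_eq_1 order_less_le)
    then have Q: "(\<lambda>i j. A i j / of_real (e j)) \<in> Gamma_infty_carrier"
      by (rule Gamma_infty_carrier_subsupport[OF A']) simp
    moreover have "A i j = 0" if "e j = 0" for i j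
      using le[of i j] that by simp
    ultimately show "(\<forall>i j. column_quotient e A i j = A i j / of_real (e j)) \<and>
      (\<forall>i j. column_quotient e A i j * of_real (e j) = A i j)"
      by (auto simp: column_quotient_def)
  qed
  show thesis
  proof (rule that[of F])
    \<comment> \<open>Every tail contains its own starting point.\<close>
    show "F \<noteq> bot"
      unfolding trivial_limit_def F using \<open>D \<noteq> {}\<close> by auto
    show "\<forall>\<^sub>F e in F. diag_mat (\<lambda>j. of_real (e j)) \<in> I"
      unfolding F using \<open>D \<noteq> {}\<close> by (auto simp: D_def)
    show "\<forall>\<^sub>F e in F. column_quotient e A \<otimes>\<^bsub>Gamma_infty\<^esub> diag_mat (\<lambda>j. of_real (e j)) = A"
      if "A \<in> I" for A
      using quot[OF that]
    proof eventually_elim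
      case (elim e)
      show ?case
        by (intro ext) (simp only: Gamma_infty_simps mult_diag_mat conjunct2[OF elim, rule_format])
    qed
    show "\<forall>\<^sub>F e in F. column_quotient e (A \<oplus>\<^bsub>Gamma_infty\<^esub> B)
        = column_quotient e A \<oplus>\<^bsub>Gamma_infty\<^esub> column_quotient e B" if "A \<in> I" "B \<in> I" for A B
      using quot[OF that(1)] quot[OF that(2)] quot[OF add[OF that]]
      by eventually_elim (simp add: Gamma_infty_simps fun_eq_iff add_divide_distrib)
    show "\<forall>\<^sub>F e in F. column_quotient e (A \<otimes>\<^bsub>Gamma_infty\<^esub> B) = A \<otimes>\<^bsub>Gamma_infty\<^esub> column_quotient e B"
      if "A \<in> carrier Gamma_infty" "B \<in> I" for A B
      \<comment> \<open>The product lies in \<open>I\<close> again, so its quotient is genuine too;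
        division by \<open>e j\<close> then passes through the finite sum over a row of
        \<open>A\<close>.\<close>
      using quot[OF that(2)] quot[OF I_l_closed[OF that(2,1)]]
    proof eventually_elim
      case (elim e)
      have "A \<in> Gamma_infty_carrier" using that(1) by (simp add: Gamma_infty_simps)
      note row = inf_mat_mult_row[OF Gamma_infty_carrierD(1)[OF this] order_refl]
      show ?case using elim by (simp add: Gamma_infty_simps fun_eq_iff row sum_divide_distrib)
    qed
  qed
qed

section \<open>Transposition and flatness on both sides\<close>

definition transpose_mat :: "(nat \<Rightarrow> nat \<Rightarrow> complex) \<Rightarrow> nat \<Rightarrow> nat \<Rightarrow> complex" where
  "transpose_mat A = (\<lambda>i j. A j i)"

lemma transpose_mat_transpose_mat [simp]: "transpose_mat (transpose_mat A) = A"
  by (simp add: transpose_mat_def)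

lemma transpose_mat_diag_mat [simp]: "transpose_mat (diag_mat d) = diag_mat d"
  by (auto simp: transpose_mat_def diag_mat_def fun_eq_iff)

lemma transpose_mat_closed [simp]: "transpose_mat A \<in> carrier Gamma_infty \<longleftrightarrow> A \<in> carrier Gamma_infty"
  by (auto simp: Gamma_infty_def transpose_mat_def Gamma_infty_carrier_def)

lemma transpose_mat_mult:
  "transpose_mat (A \<otimes>\<^bsub>Gamma_infty\<^esub> B) = transpose_mat B \<otimes>\<^bsub>Gamma_infty\<^esub> transpose_mat A"
  by (simp add: Gamma_infty_simps transpose_mat_def inf_mat_mult_def mult.commute)

lemma transpose_mat_add:
  "transpose_mat (A \<oplus>\<^bsub>Gamma_infty\<^esub> B) = transpose_mat A \<oplus>\<^bsub>Gamma_infty\<^esub> transpose_mat B"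
  by (simp add: Gamma_infty_simps transpose_mat_def)

text \<open>Transposition reverses products, so left absorption in the preimage comes from right
  absorption in \<open>I\<close>, and conversely.\<close>

lemma ideal_transpose_mat:
  assumes "ideal I Gamma_infty"
  shows "ideal (transpose_mat -` I) Gamma_infty"
proof -
  interpret ideal I Gamma_infty by fact
  have zero: "transpose_mat \<zero>\<^bsub>Gamma_infty\<^esub> = \<zero>\<^bsub>Gamma_infty\<^esub>"
    by (simp add: transpose_mat_def Gamma_infty_simps)
  \<comment> \<open>Additive inverses are known only abstractly here, so the transpose of a negative
    is identified by uniqueness of inverses.\<close>
  have minus: "\<ominus>\<^bsub>Gamma_infty\<^esub> A \<in> transpose_mat -` I" if A: "A \<in> transpose_mat -` I" for A
  proof -
    have A': "A \<in> carrier Gamma_infty" using A a_Hcarr[of "transpose_mat A"] by simp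
    then have "transpose_mat (\<ominus>\<^bsub>Gamma_infty\<^esub> A) \<oplus>\<^bsub>Gamma_infty\<^esub> transpose_mat A = \<zero>\<^bsub>Gamma_infty\<^esub>"
      by (simp add: transpose_mat_add[symmetric] l_neg zero)
    then have "transpose_mat (\<ominus>\<^bsub>Gamma_infty\<^esub> A) = \<ominus>\<^bsub>Gamma_infty\<^esub> transpose_mat A"
      using A' by (metis a_inv_closed minus_equality transpose_mat_closed)
    then show ?thesis using A by simp
  qed
  show ?thesis
  proof (rule idealI[OF ring_Gamma_infty])
    show "subgroup (transpose_mat -` I) (add_monoid Gamma_infty)"
    proof
      show "transpose_mat -` I \<subseteq> carrier (add_monoid Gamma_infty)"
        using a_Hcarr transpose_mat_closed by fastforce
      show "inv\<^bsub>add_monoid Gamma_infty\<^esub> A \<in> transpose_mat -` I" if "A \<in> transpose_mat -` I" for A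
        using minus[OF that] by (simp add: a_inv_def)
    qed (auto simp: transpose_mat_add zero)
  qed (auto simp: transpose_mat_mult I_l_closed I_r_closed)
qed

theorem proposition3p6:
  fixes I :: "(nat \<Rightarrow> nat \<Rightarrow> complex) set"
  assumes "ideal I Gamma_infty"
  shows
   "flat_left_module TYPE('m) TYPE('n) Gamma_infty (left_ideal_module Gamma_infty I) \<and>
    flat_right_module TYPE('m) TYPE('n) Gamma_infty (right_ideal_module Gamma_infty I)"
proof
  interpret ideal I Gamma_infty by fact
  have sub: "I \<subseteq> carrier Gamma_infty" using a_Hcarr by blast
  obtain F where "F \<noteq> bot" "\<forall>\<^sub>F e in F. diag_mat (\<lambda>j. of_real (e j)) \<in> I"
    and *: "\<And>A. A \<in> I \<Longrightarrow> \<forall>\<^sub>F e in F.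
      column_quotient e A \<otimes>\<^bsub>Gamma_infty\<^esub> diag_mat (\<lambda>j. of_real (e j)) = A"
    "\<And>A B. \<lbrakk>A \<in> I; B \<in> I\<rbrakk> \<Longrightarrow> \<forall>\<^sub>F e in F.
      column_quotient e (A \<oplus>\<^bsub>Gamma_infty\<^esub> B) = column_quotient e A \<oplus>\<^bsub>Gamma_infty\<^esub> column_quotient e B"
    "\<And>A B. \<lbrakk>A \<in> carrier Gamma_infty; B \<in> I\<rbrakk> \<Longrightarrow> \<forall>\<^sub>F e in F.
      column_quotient e (A \<otimes>\<^bsub>Gamma_infty\<^esub> B) = A \<otimes>\<^bsub>Gamma_infty\<^esub> column_quotient e B"
    by (rule ideal_Gamma_infty_eventually_cyclic[OF assms]) (rule that)
  then show "flat_left_module TYPE('m) TYPE('n) Gamma_infty (left_ideal_module Gamma_infty I)"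
    using flat_left_module_left_ideal_if_eventually_cyclic[OF left_module_ideal sub, of F
        "\<lambda>e. diag_mat (\<lambda>j. of_real (e j))" column_quotient]
    by (simp add: column_quotient_closed)
  \<comment> \<open>\<open>?q e A\<close> is the row analogue of the column quotient: where genuine,
    it divides row \<open>i\<close> of \<open>A\<close> by \<open>e i\<close>. The filter
    \<open>G\<close> belongs to the transposed ideal.\<close>
  let ?I = "transpose_mat -` I" and ?q = "\<lambda>e A. transpose_mat (column_quotient e (transpose_mat A))"
  obtain G where G: "G \<noteq> bot" "\<forall>\<^sub>F e in G. diag_mat (\<lambda>j. of_real (e j)) \<in> ?I"
    and *: "\<And>A. A \<in> ?I \<Longrightarrow> \<forall>\<^sub>F e in G.
      column_quotient e A \<otimes>\<^bsub>Gamma_infty\<^esub> diag_mat (\<lambda>j. of_real (e j)) = A"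
    "\<And>A B. \<lbrakk>A \<in> ?I; B \<in> ?I\<rbrakk> \<Longrightarrow> \<forall>\<^sub>F e in G.
      column_quotient e (A \<oplus>\<^bsub>Gamma_infty\<^esub> B) = column_quotient e A \<oplus>\<^bsub>Gamma_infty\<^esub> column_quotient e B"
    "\<And>A B. \<lbrakk>A \<in> carrier Gamma_infty; B \<in> ?I\<rbrakk> \<Longrightarrow> \<forall>\<^sub>F e in G.
      column_quotient e (A \<otimes>\<^bsub>Gamma_infty\<^esub> B) = A \<otimes>\<^bsub>Gamma_infty\<^esub> column_quotient e B"
    by (rule ideal_Gamma_infty_eventually_cyclic[OF ideal_transpose_mat[OF assms]]) (rule that)
  show "flat_right_module TYPE('m) TYPE('n) Gamma_infty (right_ideal_module Gamma_infty I)"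
  proof (rule flat_right_module_right_ideal_if_eventually_cyclic[OF right_module_ideal sub G(1),
        where q = ?q])
    show "\<forall>\<^sub>F e in G. diag_mat (\<lambda>j. of_real (e j)) \<in> I" using G(2) by simp
    show "?q e A \<in> carrier Gamma_infty" for e A by (simp add: column_quotient_closed)
    \<comment> \<open>Diagonal matrices equal their transposes, so transposing the factorisation of
      \<open>transpose_mat A\<close> puts the same diagonal on the left.\<close>
    show "\<forall>\<^sub>F e in G. diag_mat (\<lambda>j. of_real (e j)) \<otimes>\<^bsub>Gamma_infty\<^esub> ?q e A = A" if "A \<in> I" for A
    proof -
      have "transpose_mat A \<in> ?I" using that by simp
      from *(1)[OF this] show ?thesis
        by eventually_elim (metis transpose_mat_mult transpose_mat_diag_mat transpose_mat_transpose_mat)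
    qed
    show "\<forall>\<^sub>F e in G. ?q e (A \<oplus>\<^bsub>Gamma_infty\<^esub> B) = ?q e A \<oplus>\<^bsub>Gamma_infty\<^esub> ?q e B"
      if "A \<in> I" "B \<in> I" for A B
      using *(2)[of "transpose_mat A" "transpose_mat B"] that by (simp add: transpose_mat_add[symmetric])
        (auto simp: transpose_mat_add elim!: eventually_mono)
    show "\<forall>\<^sub>F e in G. ?q e (B \<otimes>\<^bsub>Gamma_infty\<^esub> A) = ?q e B \<otimes>\<^bsub>Gamma_infty\<^esub> A"
      if "A \<in> carrier Gamma_infty" "B \<in> I" for A B
      \<comment> \<open>Right multiplication by \<open>A\<close> becomes left multiplication by
        \<open>transpose_mat A\<close>, with which column quotients commute.\<close>
      using *(3)[of "transpose_mat A" "transpose_mat B"] that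
      by (auto simp: transpose_mat_mult elim!: eventually_mono)
  qed
qed

end
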